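(* Let $\Omega=(B,\mathbf x,R,\mathbf Z)$ be a seed of rank $3$, and suppose $\mu_1,\mu_2,\mu_3\in\mathcal S(\Omega)$. Let $$A_1=0_{3\times3},\quad A_2=\begin{bmatrix}0&2&-2\\-2&0&2\\2&-2&0\end{bmatrix},\quad A_3=\begin{bmatrix}0&1&-1\\-4&0&2\\4&-2&0\end{bmatrix},\quad A_4=\begin{bmatrix}0&4&-4\\-1&0&2\\1&-2&0\end{bmatrix}.$$ (i) If $\mu_i(B)=-B$ for all $i\in[1,3]$, then $\mathbb Q[\mathbf x^{\pm}]^{\langle\mu_1,\mu_2,\mu_3\rangle}\ne\mathbb Q$ if and only if $BR=\sigma(A_k)$ for some $k\in[1,4]$ and $\sigma\in\mathfrak S_3$. (ii) $\mathbb Q[\mathbf x^{\pm}]^{\langle\mu_1,\mu_2,\mu_3\rangle}\ne\mathbb Q$ if and only if $BR=\sigma(A)$ for some $\sigma\in\mathfrak S_3$ and some $A$ which is one of $A_1,A_2,A_3,A_4$ or of the form $$A_5=\begin{bmatrix}0&b&0\\c&0&0\\0&0&0\end{bmatrix}\quad\text{with } b,c\in\mathbb Z_{\ne0}.$$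
   Context: A seed of rank $3$ is $\Omega=(B,\mathbf x,R,\mathbf Z)$: $B=(b_{ij})$ a $3\times3$ skew-symmetrizable integer matrix; $\mathbf x=(x_1,x_2,x_3)$ free generators of $\mathbb Q(x_1,x_2,x_3)$ (the cluster); $R=\mathrm{diag}(r_1,r_2,r_3)$ with positive integers; $\mathbf Z=(Z_1,Z_2,Z_3)$ with $Z_k(u)=\sum_{i=0}^{r_k}z_{k,i}u^i\in\mathbb Z_{\ge0}[u]$, $z_{k,i}=z_{k,r_k-i}$, $z_{k,0}=z_{k,r_k}=1$. With $B_s=(b_{1s},b_{2s},b_{3s})$ and $[\cdot]_+=\max\{\cdot,0\}$ componentwise, $P_{\Omega,s}(\mathbf x)=\sum_{i=0}^{r_s}z_{s,i}\mathbf x^{i[B_s]_++(r_s-i)[-B_s]_+}$. The mutation is $\mu_s(B,\mathbf x,R,\mathbf Z)=(\mu_s(B),\mathbf x',R,\mathbf Z)$, where $\mu_s(B)=(b'_{ij})$ with $b'_{ij}=-b_{ij}$ if $i=s$ or $j=s$, $b'_{ij}=b_{ij}+r_s([b_{is}]_+b_{sj}+b_{is}[-b_{sj}]_+)$ otherwise, and $x'_s=P_{\Omega,s}(\mathbf x)/x_s$, $x'_j=x_j$ for $j\neq s$. $\mathcal S(\Omega)$ is the set of all $\sigma\mu_s$ (first $\mu_s$, then the index permutation $\sigma$) sending $(B,\mathbf x,R,\mathbf Z)$ to $(\pm B,\mathbf x',R,\mathbf Z)$ for some $\mathbf x'$; in particular $\mu_s\in\mathcal S(\Omega)$ iff $\mu_s(B)=\pm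 B$. For a matrix $A=(a_{ij})$, $\sigma(A)=(a_{\sigma(i)\sigma(j)})$. $\mathbb Q[\mathbf x^{\pm}]^{G}=\{F\in\mathbb Q[\mathbf x^{\pm}]\mid F(g(\mathbf x))=F(\mathbf x)\ \forall g\in G\}$, with $\mu_s$ acting on clusters by $\mathbf x\mapsto\mathbf x'$. *)

theory Defs
  imports
    "HOL-Analysis.Analysis"
    "HOL-Library.Poly_Mapping"
    "HOL-Computational_Algebra.Polynomial"
    "HOL-Algebra.Bij"
    "HOL-Algebra.Generated_Groups"
begin

text \<open>
  Indices range over the type \<^typ>\<open>3\<close>, whose elements are \<open>1\<close>, \<open>2\<close> and \<open>3 = 0\<close>.
  Polynomials and Laurent polynomials in three variables over the rationals are finitely
  supported maps from exponent vectors to coefficients (the monoid algebras of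
  \<open>nat ^ 3\<close> and \<open>int ^ 3\<close>).
\<close>

type_synonym poly3 = "(nat ^ 3) \<Rightarrow>\<^sub>0 rat"
type_synonym laurent3 = "(int ^ 3) \<Rightarrow>\<^sub>0 rat"

definition poly_at :: "poly3 \<Rightarrow> 'k::field_char_0 ^ 3 \<Rightarrow> 'k" where
  "poly_at F x =
     (\<Sum>a\<in>Poly_Mapping.keys F. of_rat (Poly_Mapping.lookup F a) * (\<Prod>i\<in>UNIV. (x $ i) ^ (a $ i)))"

definition laurent_at :: "laurent3 \<Rightarrow> 'k::field_char_0 ^ 3 \<Rightarrow> 'k" where
  "laurent_at F x =
     (\<Sum>a\<in>Poly_Mapping.keys F. of_rat (Poly_Mapping.lookup F a) * (\<Prod>i\<in>UNIV. (x $ i) powi (a $ i)))"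

text \<open>
  The entries of \<open>x\<close> are algebraically independent over the rationals and generate the whole
  field \<open>'k\<close>.  Thus, as soon as some \<open>x\<close> has this property, \<open>'k\<close> is a field of rational
  functions in three variables over the rationals, the ambient field of the seeds below.
\<close>

definition free_generators :: "'k::field_char_0 ^ 3 \<Rightarrow> bool" where
  "free_generators x \<longleftrightarrow>
     (\<forall>F. poly_at F x = 0 \<longrightarrow> F = 0) \<and>
     (\<forall>y. \<exists>F G. poly_at G x \<noteq> 0 \<and> y = poly_at F x / poly_at G x)"

definition skew_symmetrizable :: "int ^ 3 ^ 3 \<Rightarrow> bool" where
  "skew_symmetrizable B \<longleftrightarrow>
     (\<exists>d :: 3 \<Rightarrow> int. (\<forall>i. d i > 0) \<and> (\<forall>i j. d i * B $ i $ j = - (d j * B $ j $ i)))"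

text \<open>
  The diagonal matrix \<open>R\<close> is stored as the function of its diagonal entries; the coefficients
  of the exchange polynomials \<open>Z\<close> are nonnegative integers by their type.
\<close>

record 'k pre_seed =
  B_mat :: "int ^ 3 ^ 3"
  cluster :: "'k ^ 3"
  r_deg :: "3 \<Rightarrow> nat"
  Z_poly :: "3 \<Rightarrow> nat poly"

definition R_mat :: "'k pre_seed \<Rightarrow> int ^ 3 ^ 3" where
  "R_mat \<Omega> = (\<chi> i j. if i = j then int (r_deg \<Omega> i) else 0)"

definition seeds :: "'k::field_char_0 pre_seed set" where
  "seeds = {\<Omega>. skew_symmetrizable (B_mat \<Omega>) \<and> free_generators (cluster \<Omega>) \<and>
     (\<forall>k. r_deg \<Omega> k > 0 \<and> degree (Z_poly \<Omega> k) = r_deg \<Omega> k \<and>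
       (\<forall>i \<le> r_deg \<Omega> k. coeff (Z_poly \<Omega> k) i = coeff (Z_poly \<Omega> k) (r_deg \<Omega> k - i)) \<and>
       coeff (Z_poly \<Omega> k) 0 = 1 \<and> coeff (Z_poly \<Omega> k) (r_deg \<Omega> k) = 1)}"

definition pos_part :: "int \<Rightarrow> int" where
  "pos_part a = max a 0"

definition exchange_poly :: "'k::field_char_0 pre_seed \<Rightarrow> 3 \<Rightarrow> 'k ^ 3 \<Rightarrow> 'k" where
  "exchange_poly \<Omega> s x =
     (\<Sum>i = 0..r_deg \<Omega> s. of_nat (coeff (Z_poly \<Omega> s) i) *
        (\<Prod>j\<in>UNIV. (x $ j) powi (int i * pos_part (B_mat \<Omega> $ j $ s)
                              + int (r_deg \<Omega> s - i) * pos_part (- B_mat \<Omega> $ j $ s))))"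

definition mutate_B :: "3 \<Rightarrow> 'k pre_seed \<Rightarrow> int ^ 3 ^ 3" where
  "mutate_B s \<Omega> = (let B = B_mat \<Omega> in
     (\<chi> i j. if i = s \<or> j = s then - B $ i $ j
            else B $ i $ j + int (r_deg \<Omega> s) *
              (pos_part (B $ i $ s) * B $ s $ j + B $ i $ s * pos_part (- B $ s $ j))))"

definition mutate_cluster :: "3 \<Rightarrow> 'k::field_char_0 pre_seed \<Rightarrow> 'k ^ 3" where
  "mutate_cluster s \<Omega> = (let x = cluster \<Omega> in
     (\<chi> j. if j = s then exchange_poly \<Omega> s x / x $ s else x $ j))"

definition mutate :: "3 \<Rightarrow> 'k::field_char_0 pre_seed \<Rightarrow> 'k pre_seed" where
  "mutate s \<Omega> = \<Omega>\<lparr>B_mat := mutate_B s \<Omega>, cluster := mutate_cluster s \<Omega>\<rparr>"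

definition perm_mat :: "(3 \<Rightarrow> 3) \<Rightarrow> int ^ 3 ^ 3 \<Rightarrow> int ^ 3 ^ 3" where
  "perm_mat \<sigma> A = (\<chi> i j. A $ \<sigma> i $ \<sigma> j)"

definition perm_seed :: "(3 \<Rightarrow> 3) \<Rightarrow> 'k pre_seed \<Rightarrow> 'k pre_seed" where
  "perm_seed \<sigma> \<Omega> = \<lparr>B_mat = perm_mat \<sigma> (B_mat \<Omega>), cluster = (\<chi> i. cluster \<Omega> $ \<sigma> i),
     r_deg = r_deg \<Omega> \<circ> \<sigma>, Z_poly = Z_poly \<Omega> \<circ> \<sigma>\<rparr>"

definition symmetric_maps ::
  "'k::field_char_0 pre_seed \<Rightarrow> ('k pre_seed \<Rightarrow> 'k pre_seed) set" where
  "symmetric_maps \<Omega> = {perm_seed \<sigma> \<circ> mutate s | \<sigma> s. \<sigma> permutes UNIV \<and>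
     (\<exists>x'. perm_seed \<sigma> (mutate s \<Omega>) = \<Omega>\<lparr>cluster := x'\<rparr> \<or>
           perm_seed \<sigma> (mutate s \<Omega>) = \<Omega>\<lparr>B_mat := - B_mat \<Omega>, cluster := x'\<rparr>)}"

text \<open>
  Each mutation is a bijection (in fact an involution) of the set of seeds, so the mutations
  generate a subgroup of the group of bijections of that set.  Elements of
  \<^const>\<open>BijGroup\<close> are functions that are \<^const>\<open>undefined\<close> outside the carrier set,
  hence the restriction.
\<close>

definition mutation_group :: "('k::field_char_0 pre_seed \<Rightarrow> 'k pre_seed) set" where
  "mutation_group = generate (BijGroup seeds) (range (\<lambda>s. restrict (mutate s) seeds))"

text \<open>
  For a map \<open>g\<close> of seeds, \<open>g(x)\<close> is the cluster of the seed \<open>g \<Omega>\<close>, where \<open>x\<close> is the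
  cluster of \<open>\<Omega>\<close>.
\<close>

definition invariant_laurent ::
  "('k::field_char_0 pre_seed \<Rightarrow> 'k pre_seed) set \<Rightarrow> 'k pre_seed \<Rightarrow> laurent3 set" where
  "invariant_laurent G \<Omega> =
     {F. \<forall>g\<in>G. laurent_at F (cluster (g \<Omega>)) = laurent_at F (cluster \<Omega>)}"

definition constant_laurent :: "laurent3 set" where
  "constant_laurent = range (Poly_Mapping.single 0)"

definition mat3 :: "int list list \<Rightarrow> int ^ 3 ^ 3" where
  "mat3 xss = vector (map vector xss)"

definition A1 :: "int ^ 3 ^ 3" where
  "A1 = 0"

definition A2 :: "int ^ 3 ^ 3" where
  "A2 = mat3 [[0, 2, -2], [-2, 0, 2], [2, -2, 0]]"

definition A3 :: "int ^ 3 ^ 3" where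
  "A3 = mat3 [[0, 1, -1], [-4, 0, 2], [4, -2, 0]]"

definition A4 :: "int ^ 3 ^ 3" where
  "A4 = mat3 [[0, 4, -4], [-1, 0, 2], [1, -2, 0]]"

definition A5 :: "int \<Rightarrow> int \<Rightarrow> int ^ 3 ^ 3" where
  "A5 b c = mat3 [[0, b, 0], [c, 0, 0], [0, 0, 0]]"

end

theory Submission
  imports Defs
begin

text \<open>
  A mutation \<open>\<mu>\<^sub>s\<close> with \<open>\<mu>\<^sub>s(B) = B\<close> forces row and column \<open>s\<close> of \<open>M = BR\<close> to vanish, while
  \<open>\<mu>\<^sub>s(B) = -B\<close> reads \<open>2 m\<^sub>i\<^sub>j = - ([m\<^sub>i\<^sub>s]\<^sub>+ m\<^sub>s\<^sub>j + m\<^sub>i\<^sub>s [-m\<^sub>s\<^sub>j]\<^sub>+)\<close>. So either some row and column of \<open>M\<close> vanish,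
  or \<open>M\<close> is cyclic with \<open>2 |m\<^sub>i\<^sub>j| = |m\<^sub>i\<^sub>s| |m\<^sub>s\<^sub>j|\<close> throughout, whence \<open>|m\<^sub>i\<^sub>j m\<^sub>j\<^sub>i| = 4\<close>. Hence \<open>M\<close> is always one of the
  listed matrices, and in every case there is a nonconstant invariant, so both sides of the
  equivalence (ii) hold under the hypotheses, and \<open>A\<^sub>5\<close> is excluded in (i). With the exchange
  polynomials \<open>P\<^sub>s\<close>, the invariants are:
  \<^item> \<open>x\<^sub>r + P\<^sub>r/x\<^sub>r\<close> if column \<open>r\<close> vanishes, since then \<open>P\<^sub>r\<close> is a constant;
  \<^item> for \<open>A\<^sub>2\<close>, the generalized Markov invariant \<open>(x\<^sup>2 + y\<^sup>2 + z\<^sup>2 + a yz + b xz + c xy)/(xyz)\<close>;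
  \<^item> for \<open>A\<^sub>3\<close>, \<open>(x\<^sup>2 + P\<^sub>1 + x (2y\<^sup>2 + 2z\<^sup>2 + a yz))/(x y\<^sup>2 z\<^sup>2)\<close>, where \<open>a\<close> is the coefficient of \<open>y\<^sup>3 z\<close> in \<open>P\<^sub>1\<close>;
  \<^item> for \<open>A\<^sub>4\<close>, \<open>(x\<^sup>4 + (y + z)\<^sup>2 + b x\<^sup>2 z + c x\<^sup>2 y)/(x\<^sup>2 yz)\<close>.

  Each is, in every variable \<open>t\<close>, a function of \<open>t + P/t\<close>, which the mutation \<open>t \<mapsto> P/t\<close> preserves.
\<close>

section \<open>Evaluation of polynomials and Laurent polynomials\<close>

text \<open>Both supports are enlarged to their union, where the extra coefficients are zero. The
  weight \<open>w\<close> is arbitrary, so that ordinary and Laurent monomials are covered at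
  once.\<close>

lemma weighted_sum_add:
  fixes w :: "'a \<Rightarrow> 'k::field_char_0" and F G :: "'a \<Rightarrow>\<^sub>0 rat"
  shows "(\<Sum>a\<in>Poly_Mapping.keys (F + G). of_rat (Poly_Mapping.lookup (F + G) a) * w a)
    = (\<Sum>a\<in>Poly_Mapping.keys F. of_rat (Poly_Mapping.lookup F a) * w a) + (\<Sum>a\<in>Poly_Mapping.keys G. of_rat (Poly_Mapping.lookup G a) * w a)"
proof -
  let ?U = "Poly_Mapping.keys F \<union> Poly_Mapping.keys G"
  have *: "(\<Sum>a\<in>Poly_Mapping.keys H. of_rat (Poly_Mapping.lookup H a) * w a) = (\<Sum>a\<in>?U. of_rat (Poly_Mapping.lookup H a) * w a)"
    if "Poly_Mapping.keys H \<subseteq> ?U" for H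
    using that by (intro sum.mono_neutral_left) (auto simp: in_keys_iff)
  show ?thesis
    using keys_add[of F G]
    by (subst (1 2 3) *) (auto simp: lookup_add of_rat_add sum.distrib algebra_simps)
qed

text \<open>A multiplicative weight extends to a ring homomorphism on the monoid algebra: by
  additivity the claim reduces to monomials, first in \<open>G\<close>, then in
  \<open>F\<close>.\<close>

lemma weighted_sum_mult:
  fixes w :: "'a::monoid_add \<Rightarrow> 'k::field_char_0" and F G :: "'a \<Rightarrow>\<^sub>0 rat"
  assumes w: "\<And>a b. w (a + b) = w a * w b"
  shows "(\<Sum>a\<in>Poly_Mapping.keys (F * G). of_rat (Poly_Mapping.lookup (F * G) a) * w a)
    = (\<Sum>a\<in>Poly_Mapping.keys F. of_rat (Poly_Mapping.lookup F a) * w a) * (\<Sum>a\<in>Poly_Mapping.keys G. of_rat (Poly_Mapping.lookup G a) * w a)"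
    (is "?e (F * G) = ?e F * ?e G")
proof -
  have add: "?e (F + G) = ?e F + ?e G" for F G
    by (rule weighted_sum_add)
  have single: "?e (Poly_Mapping.single a c) = of_rat c * w a" for a c
    by simp
  \<comment> \<open>Writing at a fresh exponent is adding a monomial, which matches the induction
    over updates with additivity.\<close>
  have upd: "Poly_Mapping.update a b F = F + Poly_Mapping.single a b" if "a \<notin> Poly_Mapping.keys F" for a b and F :: "'a \<Rightarrow>\<^sub>0 rat"
    using that by (intro poly_mapping_eqI) (auto simp: lookup_update lookup_add lookup_single in_keys_iff when_def)
  have sm: "?e (Poly_Mapping.single a c * G) = of_rat c * w a * ?e G" for a c G
  proof (induction G rule: update_induct)
    case const
    then show ?case by simp
  next
    case (update F b d)
    then show ?case
      by (simp only: upd[OF update.hyps(1)] distrib_left add mult_single single w of_rat_mult update.IH) (simp add: algebra_simps)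
  qed
  show ?thesis
  proof (induction F rule: update_induct)
    case const
    then show ?case by simp
  next
    case (update F b d)
    then show ?case
      by (simp only: upd[OF update.hyps(1)] distrib_right add single sm update.IH)
  qed
qed

lemma poly_at_add: "poly_at (F + G) x = poly_at F x + poly_at G x"
  unfolding poly_at_def by (rule weighted_sum_add)

lemma poly_at_mult: "poly_at (F * G) x = poly_at F x * poly_at G x"
  unfolding poly_at_def
  by (rule weighted_sum_mult) (simp add: power_add prod.distrib)

lemma poly_at_0 [simp]: "poly_at 0 x = 0"
  by (simp add: poly_at_def)

lemma poly_at_single: "poly_at (Poly_Mapping.single a c) x = of_rat c * (\<Prod>i\<in>UNIV. x $ i ^ (a $ i))"
  by (simp add: poly_at_def)

lemma laurent_at_add: "laurent_at (F + G) x = laurent_at F x + laurent_at G x"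
  unfolding laurent_at_def by (rule weighted_sum_add)

text \<open>Exponents of \<open>powi\<close> add up only for a nonzero base, hence the restriction
  to the torus.\<close>

lemma laurent_at_mult:
  assumes "\<And>i. x $ i \<noteq> 0"
  shows "laurent_at (F * G) x = laurent_at F x * laurent_at G x"
  unfolding laurent_at_def
  by (rule weighted_sum_mult) (simp add: power_int_add prod.distrib assms)

lemma laurent_at_single:
  "laurent_at (Poly_Mapping.single a c) x = of_rat c * (\<Prod>i\<in>UNIV. x $ i powi (a $ i))"
  by (simp add: laurent_at_def)

section \<open>Polynomial functions and identities between free generators\<close>

definition polynomial_fun :: "('k::field_char_0 ^ 3 \<Rightarrow> 'k) \<Rightarrow> bool" where
  "polynomial_fun f \<longleftrightarrow> (\<exists>F. \<forall>t. poly_at F t = f t)"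

lemma polynomial_fun_const: "polynomial_fun (\<lambda>t. of_rat c)"
  unfolding polynomial_fun_def
  by (rule exI[of _ "Poly_Mapping.single 0 c"]) (simp add: poly_at_single)

lemma polynomial_fun_of_nat: "polynomial_fun (\<lambda>t. of_nat n)"
  using polynomial_fun_const[of "of_nat n"] by simp

lemma polynomial_fun_add:
  "polynomial_fun f \<Longrightarrow> polynomial_fun g \<Longrightarrow> polynomial_fun (\<lambda>t. f t + g t)"
  unfolding polynomial_fun_def by (metis poly_at_add)

lemma polynomial_fun_mult:
  "polynomial_fun f \<Longrightarrow> polynomial_fun g \<Longrightarrow> polynomial_fun (\<lambda>t. f t * g t)"
  unfolding polynomial_fun_def by (metis poly_at_mult)

lemma prod_axis:
  fixes x :: "'k::field_char_0 ^ 3"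
  shows "(\<Prod>j\<in>UNIV. x $ j ^ (axis i 1 $ j)) = x $ i"
proof -
  have "(\<Prod>j\<in>UNIV. x $ j ^ (axis i 1 $ j)) = (\<Prod>j\<in>UNIV. if j = i then x $ i else 1)"
    by (intro prod.cong) (auto simp: axis_def)
  then show ?thesis by simp
qed

lemma polynomial_fun_coord: "polynomial_fun (\<lambda>t. t $ i)"
  unfolding polynomial_fun_def
  by (rule exI[of _ "Poly_Mapping.single (axis i 1) 1"]) (simp only: poly_at_single prod_axis of_rat_1 mult_1 simp_thms)

lemma polynomial_fun_power: "polynomial_fun f \<Longrightarrow> polynomial_fun (\<lambda>t. f t ^ n)"
  using polynomial_fun_of_nat[of 1] by (induction n) (auto intro: polynomial_fun_mult)

lemma polynomial_fun_sum:
  "(\<And>i. i \<in> A \<Longrightarrow> polynomial_fun (f i)) \<Longrightarrow> polynomial_fun (\<lambda>t. \<Sum>i\<in>A. f i t)"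
  using polynomial_fun_of_nat[of 0]
  by (induction A rule: infinite_finite_induct) (auto intro: polynomial_fun_add)

lemma polynomial_fun_prod:
  "(\<And>i. i \<in> A \<Longrightarrow> polynomial_fun (f i)) \<Longrightarrow> polynomial_fun (\<lambda>t. \<Prod>i\<in>A. f i t)"
  using polynomial_fun_of_nat[of 1]
  by (induction A rule: infinite_finite_induct) (auto intro: polynomial_fun_mult)

text \<open>Free generators satisfy no polynomial relation, so a polynomial vanishing at them is
  zero and vanishes everywhere.\<close>

lemma polynomial_identity_transfer:
  assumes "free_generators x" "polynomial_fun f" "f x = 0"
  shows "f t = 0"
  using assms unfolding polynomial_fun_def free_generators_def by (metis poly_at_0)

text \<open>A coordinate vanishing at \<open>x\<close> would vanish identically, but it equals 1 at
  the all-ones vector.\<close>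

lemma free_generators_nonzero: "free_generators x \<Longrightarrow> x $ i \<noteq> 0"
  using polynomial_identity_transfer[OF _ polynomial_fun_coord, of x i "1"] by auto

section \<open>Mutation as an involution of the seeds\<close>

lemma seedsD:
  assumes "\<Omega> \<in> seeds"
  shows "skew_symmetrizable (B_mat \<Omega>)" "free_generators (cluster \<Omega>)" "r_deg \<Omega> k > 0"
    "coeff (Z_poly \<Omega> k) 0 = 1" "coeff (Z_poly \<Omega> k) (r_deg \<Omega> k) = 1"
    "i \<le> r_deg \<Omega> k \<Longrightarrow> coeff (Z_poly \<Omega> k) (r_deg \<Omega> k - i) = coeff (Z_poly \<Omega> k) i"
  using assms unfolding seeds_def mem_Collect_eq by metis+

lemma exchange_poly_polynomial_fun: "polynomial_fun (exchange_poly \<Omega> s)"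
proof -
  have "polynomial_fun (\<lambda>x::'a^3. \<Sum>i = 0..r_deg \<Omega> s. of_nat (coeff (Z_poly \<Omega> s) i) *
        (\<Prod>j\<in>UNIV. (x $ j) ^ nat (int i * pos_part (B_mat \<Omega> $ j $ s)
                              + int (r_deg \<Omega> s - i) * pos_part (- B_mat \<Omega> $ j $ s))))"
    by (intro polynomial_fun_sum polynomial_fun_mult polynomial_fun_of_nat polynomial_fun_prod
        polynomial_fun_power polynomial_fun_coord)
  also have "(\<lambda>x::'a^3. \<Sum>i = 0..r_deg \<Omega> s. of_nat (coeff (Z_poly \<Omega> s) i) *
        (\<Prod>j\<in>UNIV. (x $ j) ^ nat (int i * pos_part (B_mat \<Omega> $ j $ s)
                              + int (r_deg \<Omega> s - i) * pos_part (- B_mat \<Omega> $ j $ s))))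
     = exchange_poly \<Omega> s"
    unfolding exchange_poly_def
    by (intro ext sum.cong prod.cong arg_cong2[of _ _ _ _ "(*)"] refl power_int_nonneg_exp[symmetric])
      (simp add: pos_part_def)
  finally show ?thesis .
qed

text \<open>The value is \<open>Z_s(1)\<close>, a natural number at least 1, in characteristic zero.
  This rules out that the exchange polynomial is identically zero.\<close>

lemma exchange_poly_one_nonzero:
  fixes \<Omega> :: "'k::field_char_0 pre_seed"
  assumes "\<Omega> \<in> seeds"
  shows "exchange_poly \<Omega> s 1 \<noteq> 0"
proof -
  have "exchange_poly \<Omega> s 1 = of_nat (\<Sum>i = 0..r_deg \<Omega> s. coeff (Z_poly \<Omega> s) i)"
    by (simp add: exchange_poly_def)
  moreover have "coeff (Z_poly \<Omega> s) 0 \<noteq> 0"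
    using seedsD(4)[OF assms] by simp
  then have "(\<Sum>i = 0..r_deg \<Omega> s. coeff (Z_poly \<Omega> s) i) \<noteq> 0"
    by (auto simp del: coeff_0)
  ultimately show ?thesis
    by (metis of_nat_eq_0_iff)
qed

lemma exchange_poly_cluster_nonzero:
  fixes \<Omega> :: "'k::field_char_0 pre_seed"
  assumes "\<Omega> \<in> seeds"
  shows "exchange_poly \<Omega> s (cluster \<Omega>) \<noteq> 0"
  using polynomial_identity_transfer[OF seedsD(2)[OF assms] exchange_poly_polynomial_fun]
    exchange_poly_one_nonzero[OF assms] by blast

text \<open>The coordinate change of \<open>mutate_cluster\<close> as a map on all points, so that
  it can be iterated and substituted into identities.\<close>

definition exchange_map :: "'k::field_char_0 pre_seed \<Rightarrow> 3 \<Rightarrow> 'k ^ 3 \<Rightarrow> 'k ^ 3" where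
  "exchange_map \<Omega> s t = (\<chi> j. if j = s then exchange_poly \<Omega> s t / t $ s else t $ j)"

lemma mutate_cluster_exchange_map: "mutate_cluster s \<Omega> = exchange_map \<Omega> s (cluster \<Omega>)"
  by (simp add: mutate_cluster_def exchange_map_def Let_def)

lemma skew_symmetrizable_diag:
  assumes "skew_symmetrizable B"
  shows "B $ i $ i = 0"
proof -
  obtain d :: "3 \<Rightarrow> int" where "d i > 0" "d i * B $ i $ i = - (d i * B $ i $ i)"
    using assms unfolding skew_symmetrizable_def by blast
  then show ?thesis by simp
qed

lemma seeds_diag: "\<Omega> \<in> seeds \<Longrightarrow> B_mat \<Omega> $ i $ i = 0"
  using seedsD(1) skew_symmetrizable_diag by blast

text \<open>Since \<open>b_ss = 0\<close>, the exchange polynomial does not involve coordinate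
  \<open>s\<close>, the only one that changes.\<close>

lemma exchange_poly_exchange_map:
  assumes "\<Omega> \<in> seeds"
  shows "exchange_poly \<Omega> s (exchange_map \<Omega> s t) = exchange_poly \<Omega> s t"
  unfolding exchange_poly_def
  using seeds_diag[OF assms, of s]
  by (intro sum.cong prod.cong arg_cong2[of _ _ _ _ "(*)"] refl)
     (auto simp: exchange_map_def pos_part_def)

lemma exchange_map_involution:
  assumes "\<Omega> \<in> seeds" "t $ s \<noteq> 0" "exchange_poly \<Omega> s t \<noteq> 0"
  shows "exchange_map \<Omega> s (exchange_map \<Omega> s t) = t"
  unfolding exchange_map_def[of _ _ "exchange_map \<Omega> s t"] exchange_poly_exchange_map[OF assms(1)]
  using assms(2,3) by (auto simp: vec_eq_iff exchange_map_def)

text \<open>Negating column \<open>s\<close> interchanges the two positive parts; reindexing by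
  \<open>i -> r_s - i\<close> and the palindromic coefficients undo this.\<close>

lemma exchange_poly_uminus:
  assumes "\<Omega> \<in> seeds" "r_deg \<Omega>' = r_deg \<Omega>" "Z_poly \<Omega>' = Z_poly \<Omega>"
    and "\<And>j. B_mat \<Omega>' $ j $ s = - B_mat \<Omega> $ j $ s"
  shows "exchange_poly \<Omega>' s x = exchange_poly \<Omega> s x"
proof -
  let ?r = "r_deg \<Omega> s"
  show ?thesis
    unfolding exchange_poly_def assms(2-)
    by (rule sum.reindex_bij_witness[of _ "\<lambda>i. ?r - i" "\<lambda>i. ?r - i"])
       (auto simp: seedsD(6)[OF assms(1)] add.commute)
qed

section \<open>The subfield generated by a triple\<close>

definition rational_in :: "'k::field_char_0 ^ 3 \<Rightarrow> 'k set" where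
  "rational_in x = {y. \<exists>F G. poly_at G x \<noteq> 0 \<and> y = poly_at F x / poly_at G x}"

lemma rational_inI: "poly_at G x \<noteq> 0 \<Longrightarrow> poly_at F x / poly_at G x \<in> rational_in x"
  unfolding rational_in_def by blast

lemma rational_in_poly: "poly_at F x \<in> rational_in x"
  using rational_inI[of "Poly_Mapping.single 0 1" x F] by (simp add: poly_at_single del: single_one)

lemma rational_in_add:
  assumes "a \<in> rational_in x" "b \<in> rational_in x"
  shows "a + b \<in> rational_in x"
proof -
  obtain F G F' G' where "poly_at G x \<noteq> 0" "a = poly_at F x / poly_at G x"
    "poly_at G' x \<noteq> 0" "b = poly_at F' x / poly_at G' x"
    using assms unfolding rational_in_def by blast
  then have "poly_at (G * G') x \<noteq> 0" "a + b = poly_at (F * G' + F' * G) x / poly_at (G * G') x"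
    by (auto simp: poly_at_add poly_at_mult field_simps)
  then show ?thesis by (metis rational_inI)
qed

lemma rational_in_mult:
  assumes "a \<in> rational_in x" "b \<in> rational_in x"
  shows "a * b \<in> rational_in x"
proof -
  obtain F G F' G' where "poly_at G x \<noteq> 0" "a = poly_at F x / poly_at G x"
    "poly_at G' x \<noteq> 0" "b = poly_at F' x / poly_at G' x"
    using assms unfolding rational_in_def by blast
  then have "poly_at (G * G') x \<noteq> 0" "a * b = poly_at (F * F') x / poly_at (G * G') x"
    by (auto simp: poly_at_mult)
  then show ?thesis by (metis rational_inI)
qed

lemma rational_in_divide:
  assumes "a \<in> rational_in x" "b \<in> rational_in x"
  shows "a / b \<in> rational_in x"
proof (cases "b = 0")
  case True
  \<comment> \<open>Here \<open>a / 0 = 0\<close> by convention.\<close>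
  then show ?thesis using rational_in_poly[of 0] by simp
next
  case False
  obtain F G F' G' where "poly_at G x \<noteq> 0" "a = poly_at F x / poly_at G x"
    "poly_at G' x \<noteq> 0" "b = poly_at F' x / poly_at G' x"
    using assms unfolding rational_in_def by blast
  with False have "poly_at (G * F') x \<noteq> 0" "a / b = poly_at (F * G') x / poly_at (G * F') x"
    by (auto simp: poly_at_mult)
  then show ?thesis by (metis rational_inI)
qed

lemma rational_in_of_rat: "of_rat c \<in> rational_in x"
  using rational_in_poly[of "Poly_Mapping.single 0 c"] by (simp add: poly_at_single)

lemma rational_in_sum: "(\<And>i. i \<in> A \<Longrightarrow> f i \<in> rational_in x) \<Longrightarrow> sum f A \<in> rational_in x"
  using rational_in_of_rat[of 0 x]
  by (induction A rule: infinite_finite_induct) (auto intro: rational_in_add)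

lemma rational_in_prod: "(\<And>i. i \<in> A \<Longrightarrow> f i \<in> rational_in x) \<Longrightarrow> prod f A \<in> rational_in x"
  using rational_in_of_rat[of 1 x]
  by (induction A rule: infinite_finite_induct) (auto intro: rational_in_mult)

lemma rational_in_power: "a \<in> rational_in x \<Longrightarrow> a ^ n \<in> rational_in x"
  using rational_in_of_rat[of 1 x] by (induction n) (auto intro: rational_in_mult)

lemma rational_in_trans:
  assumes "\<And>i. x $ i \<in> rational_in y"
  shows "rational_in x \<subseteq> rational_in y"
proof -
  have "poly_at F x \<in> rational_in y" for F
    unfolding poly_at_def
    by (intro rational_in_sum rational_in_mult rational_in_of_rat rational_in_prod
        rational_in_power assms)
  then show ?thesis
    unfolding rational_in_def[of x] by (auto intro: rational_in_divide)
qed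

section \<open>Clearing denominators in one variable\<close>

text \<open>Membership in the localization of the polynomial functions at \<open>t_s\<close>. The
  equation is asked only off \<open>t_s = 0\<close>, where division has its usual meaning.\<close>

definition clearable :: "3 \<Rightarrow> ('k::field_char_0 ^ 3 \<Rightarrow> 'k) \<Rightarrow> bool" where
  "clearable s f \<longleftrightarrow> (\<exists>N g. polynomial_fun g \<and> (\<forall>t. t $ s \<noteq> 0 \<longrightarrow> g t = t $ s ^ N * f t))"

lemma clearableI:
  "polynomial_fun g \<Longrightarrow> (\<And>t. t $ s \<noteq> 0 \<Longrightarrow> g t = t $ s ^ N * f t) \<Longrightarrow> clearable s f"
  unfolding clearable_def by blast

lemma clearable_polynomial_fun: "polynomial_fun f \<Longrightarrow> clearable s f"
  by (rule clearableI[of f _ 0]) auto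

lemma clearable_add:
  assumes "clearable s f" "clearable s g"
  shows "clearable s (\<lambda>t. f t + g t)"
proof -
  obtain N p M q where p: "polynomial_fun p" "\<And>t. t $ s \<noteq> 0 \<Longrightarrow> p t = t $ s ^ N * f t"
    and q: "polynomial_fun q" "\<And>t. t $ s \<noteq> 0 \<Longrightarrow> q t = t $ s ^ M * g t"
    using assms unfolding clearable_def by metis
  show ?thesis
  proof (rule clearableI)
    show "polynomial_fun (\<lambda>t. t $ s ^ M * p t + t $ s ^ N * q t)"
      by (intro polynomial_fun_add polynomial_fun_mult polynomial_fun_power polynomial_fun_coord p q)
    show "t $ s ^ M * p t + t $ s ^ N * q t = t $ s ^ (M + N) * (f t + g t)" if "t $ s \<noteq> 0" for t
      by (simp add: p(2)[OF that] q(2)[OF that] power_add algebra_simps)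
  qed
qed

lemma clearable_mult:
  assumes "clearable s f" "clearable s g"
  shows "clearable s (\<lambda>t. f t * g t)"
proof -
  obtain N p M q where p: "polynomial_fun p" "\<And>t. t $ s \<noteq> 0 \<Longrightarrow> p t = t $ s ^ N * f t"
    and q: "polynomial_fun q" "\<And>t. t $ s \<noteq> 0 \<Longrightarrow> q t = t $ s ^ M * g t"
    using assms unfolding clearable_def by metis
  show ?thesis
  proof (rule clearableI)
    show "polynomial_fun (\<lambda>t. p t * q t)"
      by (intro polynomial_fun_mult p q)
    show "p t * q t = t $ s ^ (N + M) * (f t * g t)" if "t $ s \<noteq> 0" for t
      by (simp add: p(2)[OF that] q(2)[OF that] power_add algebra_simps)
  qed
qed

lemma clearable_power: "clearable s f \<Longrightarrow> clearable s (\<lambda>t. f t ^ n)"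
  using clearable_polynomial_fun[OF polynomial_fun_of_nat[of 1]]
  by (induction n) (auto intro: clearable_mult)

lemma clearable_sum:
  "(\<And>i. i \<in> A \<Longrightarrow> clearable s (f i)) \<Longrightarrow> clearable s (\<lambda>t. \<Sum>i\<in>A. f i t)"
  using clearable_polynomial_fun[OF polynomial_fun_of_nat[of 0]]
  by (induction A rule: infinite_finite_induct) (auto intro: clearable_add)

lemma clearable_prod:
  "(\<And>i. i \<in> A \<Longrightarrow> clearable s (f i)) \<Longrightarrow> clearable s (\<lambda>t. \<Prod>i\<in>A. f i t)"
  using clearable_polynomial_fun[OF polynomial_fun_of_nat[of 1]]
  by (induction A rule: infinite_finite_induct) (auto intro: clearable_mult)

lemma clearable_poly_at_exchange_map: "clearable s (\<lambda>t. poly_at F (exchange_map \<Omega> s t))"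
proof -
  have "clearable s (\<lambda>t. exchange_poly \<Omega> s t / t $ s)"
    by (rule clearableI[OF exchange_poly_polynomial_fun, where N = 1]) simp
  then have "clearable s (\<lambda>t. exchange_map \<Omega> s t $ i)" for i
    by (cases "i = s") (auto simp: exchange_map_def intro!: clearable_polynomial_fun polynomial_fun_coord)
  then show ?thesis
    unfolding poly_at_def
    by (intro clearable_sum clearable_mult clearable_prod clearable_power
        clearable_polynomial_fun[OF polynomial_fun_const])
qed

lemma free_generators_exchange_map:
  assumes \<Omega>: "\<Omega> \<in> seeds" and x: "free_generators x" and P: "exchange_poly \<Omega> s x \<noteq> 0"
  shows "free_generators (exchange_map \<Omega> s x)"
proof -
  let ?y = "exchange_map \<Omega> s x"
  have xs: "x $ s \<noteq> 0"
    using free_generators_nonzero[OF x] .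
  have ys: "?y $ s \<noteq> 0"
    using xs P by (simp add: exchange_map_def)
  have inv: "exchange_map \<Omega> s ?y = x"
    by (rule exchange_map_involution[OF \<Omega> xs P])
  \<comment> \<open>After clearing denominators, \<open>F(y(x)) = 0\<close> is a polynomial identity in the free generators \<open>x\<close>,
    so it persists when \<open>x\<close> is replaced by \<open>y(x)\<close>; but \<open>y(y(x)) = x\<close>.\<close>
  have "F = 0" if F: "poly_at F ?y = 0" for F
  proof -
    obtain N g where g: "polynomial_fun g"
      "\<And>t. t $ s \<noteq> 0 \<Longrightarrow> g t = t $ s ^ N * poly_at F (exchange_map \<Omega> s t)"
      using clearable_poly_at_exchange_map[of s F \<Omega>] unfolding clearable_def by blast
    have "g x = 0"
      using g(2)[OF xs] F by simp
    then have "g ?y = 0"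
      by (rule polynomial_identity_transfer[OF x g(1)])
    then have "poly_at F x = 0"
      using g(2)[OF ys] ys inv by simp
    then show "F = 0"
      using x unfolding free_generators_def by blast
  qed
  moreover have "rational_in ?y = UNIV"
  proof -
    have coord: "?y $ i \<in> rational_in ?y" for i
      using rational_in_poly[of "Poly_Mapping.single (axis i 1) 1" ?y]
      by (simp only: poly_at_single prod_axis of_rat_1 mult_1)
    obtain H where H: "\<And>t. poly_at H t = exchange_poly \<Omega> s t"
      using exchange_poly_polynomial_fun[of \<Omega> s] unfolding polynomial_fun_def by blast
    have "x $ i \<in> rational_in ?y" for i
    proof (cases "i = s")
      case True
      \<comment> \<open>As the exchange map is an involution,
        \<open>x_s = P_s(y) / y_s\<close>.\<close>
      have "x $ s = poly_at H ?y / ?y $ s"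
        unfolding H by (subst inv[symmetric]) (simp add: exchange_map_def[of _ _ "exchange_map \<Omega> s x"])
      then show ?thesis
        using True rational_in_divide[OF rational_in_poly coord] by metis
    next
      case False
      then show ?thesis
        using coord[of i] by (simp add: exchange_map_def)
    qed
    then have "rational_in x \<subseteq> rational_in ?y"
      by (rule rational_in_trans)
    moreover have "rational_in x = UNIV"
      using x unfolding free_generators_def rational_in_def by auto
    ultimately show ?thesis by auto
  qed
  then have "\<exists>F G. poly_at G ?y \<noteq> 0 \<and> z = poly_at F ?y / poly_at G ?y" for z
    unfolding rational_in_def by blast
  ultimately show ?thesis
    unfolding free_generators_def by blast
qed

section \<open>Mutation of matrices and of seeds\<close>

text \<open>Since \<open>pos_part a - pos_part (- a) = a\<close>, the two sides differ by
  \<open>a * b - a * b\<close>. This is the freedom of sign in the mutation rule.\<close>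

lemma pos_part_exchange:
  "pos_part (- a) * b + a * pos_part b = pos_part a * b + a * pos_part (- b)"
  by (auto simp: pos_part_def max_def)

text \<open>The same symmetrizer \<open>d\<close> works after mutation, because the correction term
  is itself skew with respect to \<open>d\<close>.\<close>

lemma skew_symmetrizable_mutate_B:
  assumes "skew_symmetrizable (B_mat \<Omega>)"
  shows "skew_symmetrizable (mutate_B s \<Omega>)"
proof -
  obtain d :: "3 \<Rightarrow> int" where d: "\<And>i. d i > 0" "\<And>i j. d i * B_mat \<Omega> $ i $ j = - (d j * B_mat \<Omega> $ j $ i)"
    using assms unfolding skew_symmetrizable_def by blast
  have pp: "d i * pos_part a = pos_part (d i * a)" for i a
    using d(1)[of i] by (auto simp: pos_part_def max_def mult_less_0_iff mult_le_0_iff zero_le_mult_iff)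
  have key: "d i * (pos_part (B_mat \<Omega> $ i $ s) * B_mat \<Omega> $ s $ j + B_mat \<Omega> $ i $ s * pos_part (- B_mat \<Omega> $ s $ j))
    = - (d j * (pos_part (B_mat \<Omega> $ j $ s) * B_mat \<Omega> $ s $ i + B_mat \<Omega> $ j $ s * pos_part (- B_mat \<Omega> $ s $ i)))"
    for i j
  proof -
    let ?b = "B_mat \<Omega> $ s $ i" and ?c = "B_mat \<Omega> $ s $ j"
    \<comment> \<open>Moving the positive factor \<open>d i\<close> inside the positive part and
      using skew-symmetrizability turns column \<open>s\<close> into row \<open>s\<close>.\<close>
    have pi: "d i * pos_part (B_mat \<Omega> $ i $ s) = d s * pos_part (- ?b)"
     and pj: "d j * pos_part (B_mat \<Omega> $ j $ s) = d s * pos_part (- ?c)"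
      by (simp_all add: pp d(2)[of _ s])
    have "d i * (pos_part (B_mat \<Omega> $ i $ s) * ?c + B_mat \<Omega> $ i $ s * pos_part (- ?c))
      = (d i * pos_part (B_mat \<Omega> $ i $ s)) * ?c + (d i * B_mat \<Omega> $ i $ s) * pos_part (- ?c)"
      by (simp add: algebra_simps)
    also have "\<dots> = - ((d j * pos_part (B_mat \<Omega> $ j $ s)) * ?b + (d j * B_mat \<Omega> $ j $ s) * pos_part (- ?b))"
      unfolding pi pj d(2)[of i s] d(2)[of j s] by (simp add: algebra_simps)
    finally show ?thesis
      by (simp add: algebra_simps)
  qed
  have "d i * mutate_B s \<Omega> $ i $ j = - (d j * mutate_B s \<Omega> $ j $ i)" for i j
  proof (cases "i = s \<or> j = s")
    case True
    then show ?thesis using d(2)[of i j] by (auto simp: mutate_B_def Let_def)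
  next
    case False
    have "d i * mutate_B s \<Omega> $ i $ j = d i * B_mat \<Omega> $ i $ j + int (r_deg \<Omega> s) *
      (d i * (pos_part (B_mat \<Omega> $ i $ s) * B_mat \<Omega> $ s $ j + B_mat \<Omega> $ i $ s * pos_part (- B_mat \<Omega> $ s $ j)))"
      using False by (simp add: mutate_B_def Let_def algebra_simps)
    moreover have "d j * mutate_B s \<Omega> $ j $ i = d j * B_mat \<Omega> $ j $ i + int (r_deg \<Omega> s) *
      (d j * (pos_part (B_mat \<Omega> $ j $ s) * B_mat \<Omega> $ s $ i + B_mat \<Omega> $ j $ s * pos_part (- B_mat \<Omega> $ s $ i)))"
      using False by (simp add: mutate_B_def Let_def algebra_simps)
    ultimately show ?thesis
      by (simp only: key[of i j] d(2)[of i j] minus_add_distrib mult_minus_right)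
  qed
  then show ?thesis
    unfolding skew_symmetrizable_def using d(1) by blast
qed

text \<open>The second mutation sees row and column \<open>s\<close> negated; by
  \<open>pos_part_exchange\<close> its correction cancels the first one.\<close>

lemma mutate_B_involution: "mutate_B s (mutate s \<Omega>) = B_mat \<Omega>"
proof -
  have "mutate_B s (mutate s \<Omega>) $ i $ j = B_mat \<Omega> $ i $ j" for i j
    using pos_part_exchange[of "B_mat \<Omega> $ i $ s" "B_mat \<Omega> $ s $ j"]
    by (auto simp: mutate_B_def mutate_def Let_def algebra_simps simp flip: distrib_left)
  then show ?thesis by (simp add: vec_eq_iff)
qed

lemma mutate_simps [simp]:
  "B_mat (mutate s \<Omega>) = mutate_B s \<Omega>"
  "cluster (mutate s \<Omega>) = mutate_cluster s \<Omega>"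
  "r_deg (mutate s \<Omega>) = r_deg \<Omega>"
  "Z_poly (mutate s \<Omega>) = Z_poly \<Omega>"
  by (simp_all add: mutate_def)

lemma mutate_in_seeds:
  assumes "\<Omega> \<in> seeds"
  shows "mutate s \<Omega> \<in> seeds"
proof -
  have "free_generators (mutate_cluster s \<Omega>)"
    unfolding mutate_cluster_exchange_map
    by (rule free_generators_exchange_map[OF assms seedsD(2)[OF assms] exchange_poly_cluster_nonzero[OF assms]])
  with assms skew_symmetrizable_mutate_B[OF seedsD(1)[OF assms]] show ?thesis
    unfolding seeds_def mem_Collect_eq mutate_simps by blast
qed

lemma exchange_poly_mutate: "\<Omega> \<in> seeds \<Longrightarrow> exchange_poly (mutate s \<Omega>) s x = exchange_poly \<Omega> s x"
  by (rule exchange_poly_uminus) (auto simp: mutate_B_def Let_def)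

text \<open>The mutated seed has column \<open>s\<close> negated and hence the same exchange
  polynomial, so both mutations apply the same involutive exchange map.\<close>

lemma mutate_involution:
  assumes "\<Omega> \<in> seeds"
  shows "mutate s (mutate s \<Omega>) = \<Omega>"
proof -
  have "mutate_cluster s (mutate s \<Omega>) = exchange_map \<Omega> s (exchange_map \<Omega> s (cluster \<Omega>))"
    unfolding mutate_cluster_exchange_map[of _ "mutate s \<Omega>"]
    by (simp add: exchange_map_def[of "mutate s \<Omega>"] exchange_map_def[of \<Omega> s "exchange_map \<Omega> s (cluster \<Omega>)"]
        exchange_poly_mutate[OF assms] mutate_cluster_exchange_map cong: if_cong)
  also have "\<dots> = cluster \<Omega>"
    by (intro exchange_map_involution assms free_generators_nonzero seedsD(2) exchange_poly_cluster_nonzero)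
  finally show ?thesis
    using mutate_B_involution[of s \<Omega>] by (simp add: mutate_def)
qed

section \<open>The group generated by the mutations\<close>

lemma restrict_mutate_Bij: "restrict (mutate s) seeds \<in> Bij seeds"
  unfolding Bij_def
  by (auto simp: mutate_in_seeds mutate_involution
      intro!: bij_betw_byWitness[where f' = "mutate s"])

text \<open>Mutations are involutions, so inverses of generators are generators again and closure of
  \<open>T\<close> under mutation suffices.\<close>

lemma mutation_group_preserves:
  assumes T: "T \<subseteq> seeds" "\<And>s \<Omega>. \<Omega> \<in> T \<Longrightarrow> mutate s \<Omega> \<in> T"
    and g: "g \<in> mutation_group" and \<Omega>: "\<Omega> \<in> T"
  shows "g \<Omega> \<in> T"
proof -
  let ?G = "BijGroup (seeds :: 'a pre_seed set)"
  interpret group ?G by (rule group_BijGroup)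
  have inv_eq: "inv\<^bsub>?G\<^esub> h = h" if "h \<in> range (\<lambda>s. restrict (mutate s) seeds)" for h
    using that restrict_mutate_Bij
    by (intro inv_equality)
      (auto simp: BijGroup_def compose_def mutate_involution mutate_in_seeds restrict_def fun_eq_iff)
  \<comment> \<open>Membership in \<open>Bij seeds\<close> is carried along because the product of
    \<open>BijGroup\<close> is composition only for its members.\<close>
  have "g \<in> Bij seeds \<and> (\<forall>\<Omega>\<in>T. g \<Omega> \<in> T)"
    using g unfolding mutation_group_def
  proof (induction rule: generate.induct)
    case one
    have "\<one>\<^bsub>?G\<^esub> \<in> Bij seeds"
      by (simp only: BijGroup_def monoid.simps id_Bij)
    moreover have "\<one>\<^bsub>?G\<^esub> \<Omega> \<in> T" if "\<Omega> \<in> T" for \<Omega>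
      using T(1) that by (auto simp: BijGroup_def)
    ultimately show ?case by blast
  next
    case (incl h)
    then show ?case using T restrict_mutate_Bij by auto
  next
    case (inv h)
    then show ?case using T restrict_mutate_Bij by (auto simp: inv_eq)
  next
    case (eng h1 h2)
    have "h1 \<otimes>\<^bsub>?G\<^esub> h2 = compose seeds h1 h2"
      using eng.IH by (simp add: BijGroup_def)
    then show ?case using eng.IH T(1) compose_Bij[of h1 seeds h2] by (auto simp: compose_eq)
  qed
  then show ?thesis using \<Omega> by blast
qed

section \<open>Invariant Laurent polynomials\<close>

text \<open>Agreement is required only on the torus, where negative powers make sense and where all
  clusters of seeds lie.\<close>

definition laurent_fun :: "('k::field_char_0 ^ 3 \<Rightarrow> 'k) \<Rightarrow> bool" where
  "laurent_fun f \<longleftrightarrow> (\<exists>F. \<forall>t. (\<forall>i. t $ i \<noteq> 0) \<longrightarrow> laurent_at F t = f t)"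

lemma laurent_fun_of_nat: "laurent_fun (\<lambda>t. of_nat n)"
  unfolding laurent_fun_def
  by (rule exI[of _ "Poly_Mapping.single 0 (of_nat n)"])
    (simp add: laurent_at_single del: single_of_nat)

lemma laurent_fun_numeral: "laurent_fun (\<lambda>t. numeral n)"
  using laurent_fun_of_nat[of "numeral n"] by simp

lemma laurent_fun_add:
  "laurent_fun f \<Longrightarrow> laurent_fun g \<Longrightarrow> laurent_fun (\<lambda>t. f t + g t)"
  unfolding laurent_fun_def by (metis laurent_at_add)

lemma laurent_fun_mult:
  "laurent_fun f \<Longrightarrow> laurent_fun g \<Longrightarrow> laurent_fun (\<lambda>t. f t * g t)"
  unfolding laurent_fun_def by (metis laurent_at_mult)

lemma laurent_fun_power: "laurent_fun f \<Longrightarrow> laurent_fun (\<lambda>t. f t ^ n)"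
  using laurent_fun_of_nat[of 1] by (induction n) (auto intro: laurent_fun_mult)

lemma prod_axis_powi:
  fixes x :: "'k::field_char_0 ^ 3"
  shows "(\<Prod>j\<in>UNIV. x $ j powi (axis i n $ j)) = x $ i powi n"
proof -
  have "(\<Prod>j\<in>UNIV. x $ j powi (axis i n $ j)) = (\<Prod>j\<in>UNIV. if j = i then x $ i powi n else 1)"
    by (intro prod.cong) (auto simp: axis_def)
  then show ?thesis by simp
qed

lemma laurent_fun_powi: "laurent_fun (\<lambda>t. t $ i powi n)"
  unfolding laurent_fun_def
  by (rule exI[of _ "Poly_Mapping.single (axis i n) 1"]) (simp add: laurent_at_single prod_axis_powi)

lemma laurent_fun_coord: "laurent_fun (\<lambda>t. t $ i)"
  using laurent_fun_powi[of i 1] by simp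

lemma laurent_fun_divide_coord: "laurent_fun f \<Longrightarrow> laurent_fun (\<lambda>t. f t / t $ i)"
  using laurent_fun_mult[OF _ laurent_fun_powi[of i "-1"], of f]
  by (simp add: power_int_minus field_class.field_divide_inverse)

lemmas laurent_fun_intros = laurent_fun_of_nat laurent_fun_numeral laurent_fun_add laurent_fun_mult
  laurent_fun_power laurent_fun_coord laurent_fun_divide_coord

text \<open>Negation swaps the signs inside the positive parts, which
  \<open>pos_part_exchange\<close> allows.\<close>

lemma mutate_B_uminus:
  assumes "r_deg \<Omega>' = r_deg \<Omega>" "B_mat \<Omega>' = - B_mat \<Omega>"
  shows "mutate_B s \<Omega>' = - mutate_B s \<Omega>"
proof -
  have "mutate_B s \<Omega>' $ i $ j = - mutate_B s \<Omega> $ i $ j" for i j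
    using pos_part_exchange[of "B_mat \<Omega> $ i $ s" "B_mat \<Omega> $ s $ j"]
    by (auto simp: mutate_B_def Let_def assms algebra_simps simp flip: distrib_left)
  then show ?thesis by (simp add: vec_eq_iff)
qed

lemma mutate_B_cong:
  "r_deg \<Omega>' = r_deg \<Omega> \<Longrightarrow> B_mat \<Omega>' = B_mat \<Omega> \<Longrightarrow> mutate_B s \<Omega>' = mutate_B s \<Omega>"
  by (simp add: mutate_B_def Let_def cong: if_cong)

text \<open>Along every sequence of mutations the matrix stays \<open>B\<close> or
  \<open>- B\<close>, so the three exchange polynomials remain the same functions. Invariance under
  three fixed exchange maps then passes to the whole group; \<open>u\<close> and \<open>v\<close>
  witness that \<open>f\<close> is not constant.\<close>

lemma nonconstant_invariant:
  fixes \<Omega> :: "'k::field_char_0 pre_seed"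
  assumes \<Omega>: "\<Omega> \<in> seeds"
    and B: "\<And>s. mutate_B s \<Omega> = B_mat \<Omega> \<or> mutate_B s \<Omega> = - B_mat \<Omega>"
    and f: "laurent_fun f"
    and inv: "\<And>s x. (\<And>i. x $ i \<noteq> 0) \<Longrightarrow> exchange_poly \<Omega> s x \<noteq> 0 \<Longrightarrow> f (exchange_map \<Omega> s x) = f x"
    and uv: "\<And>i. u $ i \<noteq> 0" "\<And>i. v $ i \<noteq> 0" "f u \<noteq> f v"
  shows "invariant_laurent mutation_group \<Omega> \<noteq> constant_laurent"
proof -
  obtain F where F: "\<And>t. (\<And>i. t $ i \<noteq> 0) \<Longrightarrow> laurent_at F t = f t"
    using f unfolding laurent_fun_def by blast
  \<comment> \<open>These seeds contain \<open>\<Omega>\<close> and are closed under mutation: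
    \<open>f\<close> keeps its value, and the data that fix the exchange maps survive up to the sign
    of \<open>B\<close>.\<close>
  define T where "T = {\<Omega>' \<in> seeds. (B_mat \<Omega>' = B_mat \<Omega> \<or> B_mat \<Omega>' = - B_mat \<Omega>) \<and>
    r_deg \<Omega>' = r_deg \<Omega> \<and> Z_poly \<Omega>' = Z_poly \<Omega> \<and> f (cluster \<Omega>') = f (cluster \<Omega>)}"
  have "mutate s \<Omega>' \<in> T" if "\<Omega>' \<in> T" for s \<Omega>'
  proof -
    have \<Omega>': "\<Omega>' \<in> seeds" and B': "B_mat \<Omega>' = B_mat \<Omega> \<or> B_mat \<Omega>' = - B_mat \<Omega>"
      and eqs: "r_deg \<Omega>' = r_deg \<Omega>" "Z_poly \<Omega>' = Z_poly \<Omega>" "f (cluster \<Omega>') = f (cluster \<Omega>)"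
      using that by (auto simp: T_def)
    have ep: "exchange_poly \<Omega>' t = exchange_poly \<Omega> t" for t
      using B'
    proof
      assume "B_mat \<Omega>' = B_mat \<Omega>"
      then show ?thesis using eqs by (simp add: exchange_poly_def fun_eq_iff)
    next
      assume "B_mat \<Omega>' = - B_mat \<Omega>"
      then show ?thesis using eqs by (intro ext exchange_poly_uminus[OF \<Omega>]) auto
    qed
    have "mutate_B s \<Omega>' = B_mat \<Omega> \<or> mutate_B s \<Omega>' = - B_mat \<Omega>"
      using B' B[of s] mutate_B_cong[OF eqs(1), of s] mutate_B_uminus[OF eqs(1), of s] by auto
    moreover have "f (mutate_cluster s \<Omega>') = f (cluster \<Omega>)"
    proof -
      have "mutate_cluster s \<Omega>' = exchange_map \<Omega> s (cluster \<Omega>')"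
        unfolding mutate_cluster_exchange_map exchange_map_def ep ..
      moreover have "f (exchange_map \<Omega> s (cluster \<Omega>')) = f (cluster \<Omega>')"
        using free_generators_nonzero[OF seedsD(2)[OF \<Omega>']] exchange_poly_cluster_nonzero[OF \<Omega>', of s]
        by (intro inv) (auto simp: ep)
      ultimately show ?thesis using eqs by simp
    qed
    ultimately show ?thesis
      using mutate_in_seeds[OF \<Omega>'] eqs by (simp add: T_def)
  qed
  moreover have "T \<subseteq> seeds" "\<Omega> \<in> T"
    using \<Omega> by (auto simp: T_def)
  ultimately have gT: "g \<Omega> \<in> T" if "g \<in> mutation_group" for g
    using that mutation_group_preserves by blast
  then have "laurent_at F (cluster (g \<Omega>)) = laurent_at F (cluster \<Omega>)" if "g \<in> mutation_group" for g
  proof -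
    have "g \<Omega> \<in> seeds" "f (cluster (g \<Omega>)) = f (cluster \<Omega>)"
      using gT[OF that] by (auto simp: T_def)
    then show ?thesis
      using F[of "cluster (g \<Omega>)"] F[of "cluster \<Omega>"] \<Omega> free_generators_nonzero[OF seedsD(2)] by metis
  qed
  then have "F \<in> invariant_laurent mutation_group \<Omega>"
    by (simp add: invariant_laurent_def)
  moreover have "F \<notin> constant_laurent"
  proof
    assume "F \<in> constant_laurent"
    then obtain c where "F = Poly_Mapping.single 0 c"
      by (auto simp: constant_laurent_def)
    then show False
      using F[of u] F[of v] uv by (simp add: laurent_at_single)
  qed
  ultimately show ?thesis by metis
qed

section \<open>Exchange polynomials read off from the columns of \<open>BR\<close>\<close>

lemma UNIV_distinct_3: "distinct [p, q, r] \<Longrightarrow> UNIV = {p, q, r :: 3}"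
  by (rule sym, rule card_subset_eq) auto

lemma prod_distinct_3: "distinct [p, q, r] \<Longrightarrow> prod f (UNIV :: 3 set) = f p * (f q * f r)"
  by (simp add: UNIV_distinct_3[of p q r])

lemma BR_nth: "(B_mat \<Omega> ** R_mat \<Omega>) $ i $ j = B_mat \<Omega> $ i $ j * int (r_deg \<Omega> j)"
  by (simp add: matrix_matrix_mult_def R_mat_def if_distrib[of "(*) _"] cong: if_cong)

text \<open>As \<open>b_ss = 0\<close> and the other two entries have weakly opposite signs, each of
  the two exponent vectors involves at most one variable, so \<open>P_s\<close> is a binary form
  with the coefficients of \<open>Z_s\<close>.\<close>

lemma exchange_poly_binary_form:
  assumes \<Omega>: "\<Omega> \<in> seeds" and d: "distinct [s, j, k]"
    and sgn: "B_mat \<Omega> $ j $ s * B_mat \<Omega> $ k $ s \<le> 0"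
  shows "exchange_poly \<Omega> s x = (\<Sum>i\<le>r_deg \<Omega> s. of_nat (coeff (Z_poly \<Omega> s) i) *
    ((x $ j ^ nat \<bar>B_mat \<Omega> $ j $ s\<bar>) ^ i * (x $ k ^ nat \<bar>B_mat \<Omega> $ k $ s\<bar>) ^ (r_deg \<Omega> s - i)))"
proof -
  have *: "exchange_poly \<Omega> s x = (\<Sum>i\<le>r_deg \<Omega> s. of_nat (coeff (Z_poly \<Omega> s) i) *
    ((x $ j ^ nat \<bar>B_mat \<Omega> $ j $ s\<bar>) ^ i * (x $ k ^ nat \<bar>B_mat \<Omega> $ k $ s\<bar>) ^ (r_deg \<Omega> s - i)))"
    if \<Omega>: "\<Omega> \<in> seeds" and sgn: "B_mat \<Omega> $ j $ s \<ge> 0" "B_mat \<Omega> $ k $ s \<le> 0" for \<Omega>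
  proof -
    have "x $ j powi (int i * b) = (x $ j ^ nat b) ^ i" if "b \<ge> 0" for i b j
      using that by (subst power_int_nonneg_exp) (auto simp: nat_mult_distrib mult.commute[of "int i"] power_mult)
    then show ?thesis
      unfolding exchange_poly_def prod_distinct_3[OF d] atMost_atLeast0
      using seeds_diag[OF \<Omega>, of s] sgn by (intro sum.cong) (auto simp: pos_part_def max_def simp del: of_nat_diff)
  qed
  show ?thesis
  proof (cases "B_mat \<Omega> $ j $ s \<ge> 0 \<and> B_mat \<Omega> $ k $ s \<le> 0")
    case True
    then show ?thesis using *[OF \<Omega>] by simp
  next
    case False
    with sgn have neg: "B_mat \<Omega> $ j $ s \<le> 0" "B_mat \<Omega> $ k $ s \<ge> 0"
      by (auto simp: mult_le_0_iff)
    \<comment> \<open>The other sign pattern is reduced to the first by negating \<open>B\<close>,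
      which leaves the exchange polynomial unchanged.\<close>
    let ?\<Omega> = "\<Omega>\<lparr>B_mat := - B_mat \<Omega>\<rparr>"
    have "B_mat ?\<Omega> = - B_mat \<Omega>" and eqs: "cluster ?\<Omega> = cluster \<Omega>" "r_deg ?\<Omega> = r_deg \<Omega>"
      "Z_poly ?\<Omega> = Z_poly \<Omega>"
      by simp_all
    obtain d :: "3 \<Rightarrow> int" where d: "\<And>i. d i > 0" "\<And>i j. d i * B_mat \<Omega> $ i $ j = - (d j * B_mat \<Omega> $ j $ i)"
      using seedsD(1)[OF \<Omega>] unfolding skew_symmetrizable_def by blast
    have "d i * B_mat ?\<Omega> $ i $ j = - (d j * B_mat ?\<Omega> $ j $ i)" for i j
      using d(2)[of i j] by simp
    with d(1) have "skew_symmetrizable (B_mat ?\<Omega>)"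
      unfolding skew_symmetrizable_def by blast
    then have "?\<Omega> \<in> seeds"
      using \<Omega> unfolding seeds_def mem_Collect_eq eqs by blast
    moreover have "B_mat ?\<Omega> $ j $ s \<ge> 0" "B_mat ?\<Omega> $ k $ s \<le> 0"
      using neg by simp_all
    ultimately have "exchange_poly ?\<Omega> s x = (\<Sum>i\<le>r_deg \<Omega> s. of_nat (coeff (Z_poly \<Omega> s) i) *
      ((x $ j ^ nat \<bar>B_mat \<Omega> $ j $ s\<bar>) ^ i * (x $ k ^ nat \<bar>B_mat \<Omega> $ k $ s\<bar>) ^ (r_deg \<Omega> s - i)))"
      by (subst *) simp_all
    moreover have "exchange_poly ?\<Omega> s x = exchange_poly \<Omega> s x"
      by (rule exchange_poly_uminus[OF \<Omega>]) simp_all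
    ultimately show ?thesis by simp
  qed
qed

text \<open>A column of \<open>BR\<close> determines only the products of the exponents
  \<open>m\<close> and \<open>n\<close> with the degree \<open>r\<close>; small entries leave few
  factorizations, which the following lemmas run through.\<close>

lemma exchange_poly_column:
  fixes \<Omega> :: "'k::field_char_0 pre_seed"
  assumes \<Omega>: "\<Omega> \<in> seeds" and d: "distinct [s, j, k]"
    and j: "(B_mat \<Omega> ** R_mat \<Omega>) $ j $ s = a" and k: "(B_mat \<Omega> ** R_mat \<Omega>) $ k $ s = b"
    and ab: "a * b \<le> 0"
  obtains m n r z where "r > 0" "m * r = nat \<bar>a\<bar>" "n * r = nat \<bar>b\<bar>" "z 0 = 1" "z r = 1"
    "\<And>i. i \<le> r \<Longrightarrow> z (r - i) = z i"
    "\<And>x. exchange_poly \<Omega> s x = (\<Sum>i\<le>r. of_nat (z i) * ((x $ j ^ m) ^ i * (x $ k ^ n) ^ (r - i)))"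
proof
  let ?r = "r_deg \<Omega> s"
  show "?r > 0" by (rule seedsD(3)[OF \<Omega>])
  show "nat \<bar>B_mat \<Omega> $ j $ s\<bar> * ?r = nat \<bar>a\<bar>" "nat \<bar>B_mat \<Omega> $ k $ s\<bar> * ?r = nat \<bar>b\<bar>"
    unfolding j[symmetric] k[symmetric] BR_nth by (simp_all add: abs_mult nat_mult_distrib)
  have "(B_mat \<Omega> $ j $ s * B_mat \<Omega> $ k $ s) * (int ?r * int ?r) \<le> 0"
    using ab unfolding j[symmetric] k[symmetric] BR_nth by (simp add: algebra_simps)
  then have "B_mat \<Omega> $ j $ s * B_mat \<Omega> $ k $ s \<le> 0"
    using \<open>?r > 0\<close> by (simp add: mult_le_0_iff)
  then show "\<And>x. exchange_poly \<Omega> s x = (\<Sum>i\<le>?r. of_nat (coeff (Z_poly \<Omega> s) i) *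
    ((x $ j ^ nat \<bar>B_mat \<Omega> $ j $ s\<bar>) ^ i * (x $ k ^ nat \<bar>B_mat \<Omega> $ k $ s\<bar>) ^ (?r - i)))"
    by (rule exchange_poly_binary_form[OF \<Omega> d])
  show "coeff (Z_poly \<Omega> s) 0 = 1" "coeff (Z_poly \<Omega> s) ?r = 1"
    by (rule seedsD(4,5)[OF \<Omega>])+
  show "coeff (Z_poly \<Omega> s) (?r - i) = coeff (Z_poly \<Omega> s) i" if "i \<le> ?r" for i
    using that by (rule seedsD(6)[OF \<Omega>])
qed

text \<open>Both exponents vanish, so \<open>P_s\<close> is the constant
  \<open>Z_s(1)\<close>.\<close>

lemma exchange_poly_column_0_0:
  fixes \<Omega> :: "'k::field_char_0 pre_seed"
  assumes \<Omega>: "\<Omega> \<in> seeds" and d: "distinct [s, j, k]"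
    and j: "(B_mat \<Omega> ** R_mat \<Omega>) $ j $ s = 0" and k: "(B_mat \<Omega> ** R_mat \<Omega>) $ k $ s = 0"
  obtains c :: nat where "\<And>x. exchange_poly \<Omega> s x = of_nat c"
proof -
  obtain m n r z where "r > 0" "m * r = nat \<bar>0\<bar>" "n * r = nat \<bar>0\<bar>"
    "z 0 = 1" "z r = 1" "\<And>i. i \<le> r \<Longrightarrow> z (r - i) = z i"
    "\<And>x. exchange_poly \<Omega> s x = (\<Sum>i\<le>r. of_nat (z i) * ((x $ j ^ m) ^ i * (x $ k ^ n) ^ (r - i)))"
    by (rule exchange_poly_column[OF \<Omega> d j k]) (simp, rule that)
  then have "\<And>x. exchange_poly \<Omega> s x = of_nat (\<Sum>i\<le>r. z i)"
    by simp
  then show thesis by (rule that)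
qed

text \<open>An entry of absolute value 1 forces degree and exponent 1, leaving only the two extreme
  coefficients.\<close>

lemma exchange_poly_column_1:
  fixes \<Omega> :: "'k::field_char_0 pre_seed"
  assumes \<Omega>: "\<Omega> \<in> seeds" and d: "distinct [s, j, k]"
    and j: "\<bar>(B_mat \<Omega> ** R_mat \<Omega>) $ j $ s\<bar> = 1"
    and sgn: "(B_mat \<Omega> ** R_mat \<Omega>) $ j $ s * (B_mat \<Omega> ** R_mat \<Omega>) $ k $ s \<le> 0"
  shows "exchange_poly \<Omega> s x = x $ j + x $ k ^ nat \<bar>(B_mat \<Omega> ** R_mat \<Omega>) $ k $ s\<bar>"
proof -
  obtain m n r z where *: "r > 0" "m * r = nat \<bar>(B_mat \<Omega> ** R_mat \<Omega>) $ j $ s\<bar>"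
    "n * r = nat \<bar>(B_mat \<Omega> ** R_mat \<Omega>) $ k $ s\<bar>" "z 0 = 1" "z r = 1"
    "\<And>i. i \<le> r \<Longrightarrow> z (r - i) = z i"
    "\<And>x. exchange_poly \<Omega> s x = (\<Sum>i\<le>r. of_nat (z i) * ((x $ j ^ m) ^ i * (x $ k ^ n) ^ (r - i)))"
    by (rule exchange_poly_column[OF \<Omega> d refl refl sgn]) (rule that)
  have "m = 1" "r = 1" using *(1,2) j by auto
  then show ?thesis using *(3,4,5,7) by (simp add: add.commute)
qed

text \<open>The degree is 1 or 2; the middle coefficient \<open>c\<close> is 0 in the first case and
  \<open>z 1\<close> in the second.\<close>

lemma exchange_poly_column_even_2:
  fixes \<Omega> :: "'k::field_char_0 pre_seed"
  assumes \<Omega>: "\<Omega> \<in> seeds" and d: "distinct [s, j, k]"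
    and j: "\<bar>(B_mat \<Omega> ** R_mat \<Omega>) $ j $ s\<bar> = int (2 * m)" and k: "\<bar>(B_mat \<Omega> ** R_mat \<Omega>) $ k $ s\<bar> = 2"
    and sgn: "(B_mat \<Omega> ** R_mat \<Omega>) $ j $ s * (B_mat \<Omega> ** R_mat \<Omega>) $ k $ s \<le> 0"
  obtains c :: nat where
    "\<And>x. exchange_poly \<Omega> s x = (x $ j ^ m) ^ 2 + of_nat c * (x $ j ^ m * x $ k) + x $ k ^ 2"
proof -
  obtain m' n r z where *: "r > 0" "m' * r = nat \<bar>(B_mat \<Omega> ** R_mat \<Omega>) $ j $ s\<bar>"
    "n * r = nat \<bar>(B_mat \<Omega> ** R_mat \<Omega>) $ k $ s\<bar>" "z 0 = 1" "z r = 1"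
    "\<And>i. i \<le> r \<Longrightarrow> z (r - i) = z i"
    "\<And>x. exchange_poly \<Omega> s x = (\<Sum>i\<le>r. of_nat (z i) * ((x $ j ^ m') ^ i * (x $ k ^ n) ^ (r - i)))"
    by (rule exchange_poly_column[OF \<Omega> d refl refl sgn]) (rule that)
  have m': "m' * r = 2 * m" and nr: "n * r = 2"
    using *(2,3) j k by auto
  then have "r dvd 2" by (metis dvd_triv_right)
  then have "r \<le> 2" by (rule dvd_imp_le) simp
  consider "r = 1" "n = 2" "m' = 2 * m" | "r = 2" "n = 1" "m' = m"
  proof -
    have "r = 1 \<or> r = 2" using \<open>r \<le> 2\<close> *(1) by linarith
    then show thesis using that nr m' by auto
  qed
  then show thesis
  proof cases
    case 1
    then have "\<And>x. exchange_poly \<Omega> s x = (x $ j ^ m) ^ 2 + of_nat 0 * (x $ j ^ m * x $ k) + x $ k ^ 2"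
      using *(4,5,7) by (simp add: power_even_eq)
    then show thesis by (rule that)
  next
    case 2
    then have "\<And>x. exchange_poly \<Omega> s x = (x $ j ^ m) ^ 2 + of_nat (z 1) * (x $ j ^ m * x $ k) + x $ k ^ 2"
      using *(4,5,7) by (simp add: numeral_2_eq_2 algebra_simps)
    then show thesis by (rule that)
  qed
qed

text \<open>The degree is 1, 2 or 4; in the lower degrees the missing coefficients are 0.\<close>

lemma exchange_poly_column_4_4:
  fixes \<Omega> :: "'k::field_char_0 pre_seed"
  assumes \<Omega>: "\<Omega> \<in> seeds" and d: "distinct [s, j, k]"
    and j: "\<bar>(B_mat \<Omega> ** R_mat \<Omega>) $ j $ s\<bar> = 4" and k: "\<bar>(B_mat \<Omega> ** R_mat \<Omega>) $ k $ s\<bar> = 4"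
    and sgn: "(B_mat \<Omega> ** R_mat \<Omega>) $ j $ s * (B_mat \<Omega> ** R_mat \<Omega>) $ k $ s \<le> 0"
  obtains c e :: nat where
    "\<And>x. exchange_poly \<Omega> s x = x $ j ^ 4 + of_nat c * (x $ j ^ 3 * x $ k) + of_nat e * (x $ j ^ 2 * x $ k ^ 2)
      + of_nat c * (x $ j * x $ k ^ 3) + x $ k ^ 4"
proof -
  obtain m n r z where *: "r > 0" "m * r = nat \<bar>(B_mat \<Omega> ** R_mat \<Omega>) $ j $ s\<bar>"
    "n * r = nat \<bar>(B_mat \<Omega> ** R_mat \<Omega>) $ k $ s\<bar>" "z 0 = 1" "z r = 1"
    "\<And>i. i \<le> r \<Longrightarrow> z (r - i) = z i"
    "\<And>x. exchange_poly \<Omega> s x = (\<Sum>i\<le>r. of_nat (z i) * ((x $ j ^ m) ^ i * (x $ k ^ n) ^ (r - i)))"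
    by (rule exchange_poly_column[OF \<Omega> d refl refl sgn]) (rule that)
  have m: "m * r = 4" "n * r = 4"
    using *(2,3) j k by auto
  then have "r dvd 4" by (metis dvd_triv_right)
  then have "r \<le> 4" by (rule dvd_imp_le) simp
  consider "r = 1" "n = 4" "m = 4" | "r = 2" "n = 2" "m = 2" | "r = 4" "n = 1" "m = 1"
  proof -
    have "r = 1 \<or> r = 2 \<or> r = 3 \<or> r = 4" using \<open>r \<le> 4\<close> *(1) by linarith
    then show thesis
    proof (elim disjE)
      assume "r = 3"
      then show thesis using m(1) by presburger
    qed (use that m in auto)
  qed
  then show thesis
  proof cases
    case 1
    then have "\<And>x. exchange_poly \<Omega> s x = x $ j ^ 4 + of_nat 0 * (x $ j ^ 3 * x $ k) + of_nat 0 * (x $ j ^ 2 * x $ k ^ 2)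
      + of_nat 0 * (x $ j * x $ k ^ 3) + x $ k ^ 4"
      using *(4,5,7) by simp
    then show thesis by (rule that)
  next
    case 2
    have "(\<Sum>i\<le>2. of_nat (z i) * ((u ^ 2) ^ i * (v ^ 2) ^ (2 - i)))
       = u ^ 4 + of_nat 0 * (u ^ 3 * v) + of_nat (z 1) * (u ^ 2 * v ^ 2) + of_nat 0 * (u * v ^ 3) + v ^ 4"
      for u v :: 'k
      using *(4,5) 2 by (simp add: eval_nat_numeral algebra_simps)
    then show thesis
      by (intro that) (simp only: *(7) 2)
  next
    case 3
    \<comment> \<open>Palindromicity gives the two odd terms a common coefficient.\<close>
    have "z 3 = z 1" using *(6)[of 1] 3 by simp
    then have "(\<Sum>i\<le>4. of_nat (z i) * ((u ^ 1) ^ i * (v ^ 1) ^ (4 - i)))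
       = u ^ 4 + of_nat (z 1) * (u ^ 3 * v) + of_nat (z 2) * (u ^ 2 * v ^ 2) + of_nat (z 1) * (u * v ^ 3) + v ^ 4"
      for u v :: 'k
      using *(4,5) 3 by (simp add: eval_nat_numeral algebra_simps)
    then show thesis
      by (intro that) (simp only: *(7) 3)
  qed
qed

section \<open>Explicit invariants for each matrix\<close>

lemma exchange_map_nth:
  "exchange_map \<Omega> s x $ j = (if j = s then exchange_poly \<Omega> s x / x $ s else x $ j)"
  by (simp add: exchange_map_def)

text \<open>\<open>y\<close> and \<open>P / y\<close> are the two roots of
  \<open>T^2 - u * T + P\<close> with \<open>u = y + P / y\<close>, and a function of their sum does
  not see them exchanged.\<close>

lemma vieta_flip:
  fixes g h :: "'k::field \<Rightarrow> 'k"
  assumes "\<And>y. y \<noteq> 0 \<Longrightarrow> g y = h (y + P / y)" "y \<noteq> 0" "P \<noteq> 0"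
  shows "g (P / y) = g y"
  using assms(1)[of y] assms(1)[of "P / y"] assms(2,3) by (simp add: add.commute)

lemma nonconstant_invariant_zero_column:
  fixes \<Omega> :: "'k::field_char_0 pre_seed"
  assumes \<Omega>: "\<Omega> \<in> seeds"
    and B: "\<And>s. mutate_B s \<Omega> = B_mat \<Omega> \<or> mutate_B s \<Omega> = - B_mat \<Omega>"
    and d: "distinct [r, p, q]"
    and M: "(B_mat \<Omega> ** R_mat \<Omega>) $ p $ r = 0" "(B_mat \<Omega> ** R_mat \<Omega>) $ q $ r = 0"
  shows "invariant_laurent mutation_group \<Omega> \<noteq> constant_laurent"
proof -
  obtain c where c: "\<And>x. exchange_poly \<Omega> r x = of_nat c"
    using exchange_poly_column_0_0[OF \<Omega> d M] by blast
  define f where "f t = t $ r + of_nat c / t $ r" for t :: "'k ^ 3"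
  have "laurent_fun f"
    unfolding f_def by (intro laurent_fun_intros)
  moreover have "f (exchange_map \<Omega> s x) = f x" if "\<And>i. x $ i \<noteq> 0" "exchange_poly \<Omega> s x \<noteq> 0" for s x
    using that by (cases "s = r") (simp_all add: f_def exchange_map_nth c)
  \<comment> \<open>\<open>f\<close> is odd, with the positive value \<open>1 + c\<close> at the
    all-ones vector.\<close>
  moreover have "f (\<chi> i. 1) \<noteq> f (\<chi> i. - 1)"
  proof
    assume "f (\<chi> i. 1) = f (\<chi> i. - 1)"
    then have "(of_nat (2 * (1 + c)) :: 'k) = 0"
      by (simp add: f_def algebra_simps)
    then show False by (simp only: of_nat_eq_0_iff) simp
  qed
  ultimately show ?thesis
    by (intro nonconstant_invariant[OF \<Omega> B, of f "\<chi> i. 1" "\<chi> i. - 1"]) auto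
qed

lemma nonconstant_invariant_2_2_2:
  fixes \<Omega> :: "'k::field_char_0 pre_seed"
  assumes \<Omega>: "\<Omega> \<in> seeds"
    and B: "\<And>s. mutate_B s \<Omega> = B_mat \<Omega> \<or> mutate_B s \<Omega> = - B_mat \<Omega>"
    and d: "distinct [p, q, r]"
    and M: "(B_mat \<Omega> ** R_mat \<Omega>) $ q $ p = - 2" "(B_mat \<Omega> ** R_mat \<Omega>) $ r $ p = 2"
      "(B_mat \<Omega> ** R_mat \<Omega>) $ p $ q = 2" "(B_mat \<Omega> ** R_mat \<Omega>) $ r $ q = - 2"
      "(B_mat \<Omega> ** R_mat \<Omega>) $ p $ r = - 2" "(B_mat \<Omega> ** R_mat \<Omega>) $ q $ r = 2"
  shows "invariant_laurent mutation_group \<Omega> \<noteq> constant_laurent"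
proof -
  obtain a where a: "\<And>x. exchange_poly \<Omega> p x = (x $ q ^ 1) ^ 2 + of_nat a * (x $ q ^ 1 * x $ r) + x $ r ^ 2"
    by (rule exchange_poly_column_even_2[OF \<Omega>, of p q r 1]) (use d M in auto)
  obtain b where b: "\<And>x. exchange_poly \<Omega> q x = (x $ p ^ 1) ^ 2 + of_nat b * (x $ p ^ 1 * x $ r) + x $ r ^ 2"
    by (rule exchange_poly_column_even_2[OF \<Omega>, of q p r 1]) (use d M in auto)
  obtain c where c: "\<And>x. exchange_poly \<Omega> r x = (x $ p ^ 1) ^ 2 + of_nat c * (x $ p ^ 1 * x $ q) + x $ q ^ 2"
    by (rule exchange_poly_column_even_2[OF \<Omega>, of r p q 1]) (use d M in auto)
  \<comment> \<open>In each variable \<open>t\<close>, up to a factor free of \<open>t\<close>, this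
    is \<open>t + P / t\<close> plus terms free of \<open>t\<close>.\<close>
  define g where "g x y z =
    (x ^ 2 + y ^ 2 + z ^ 2 + of_nat a * (y * z) + of_nat b * (x * z) + of_nat c * (x * y)) / x / y / z"
    for x y z :: 'k
  define f where "f t = g (t $ p) (t $ q) (t $ r)" for t :: "'k ^ 3"
  have "laurent_fun f"
    unfolding f_def g_def by (intro laurent_fun_intros)
  moreover have "f (exchange_map \<Omega> s t) = f t" if nz: "\<And>i. t $ i \<noteq> 0" and P: "exchange_poly \<Omega> s t \<noteq> 0" for s t
  proof -
    define x y z where "x = t $ p" "y = t $ q" "z = t $ r"
    note xyz = this
    have xyz0: "x \<noteq> 0" "y \<noteq> 0" "z \<noteq> 0" using nz by (auto simp: xyz)
    consider "s = p" | "s = q" | "s = r"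
      using UNIV_distinct_3[OF d] by blast
    then show ?thesis
    proof cases
      case 1
      have "g (exchange_poly \<Omega> p t / x) y z = g x y z"
        by (rule vieta_flip[where g = "\<lambda>x. g x y z" and h = "\<lambda>u. (u + of_nat b * z + of_nat c * y) / y / z"])
          (use P 1 xyz0 in \<open>auto simp: g_def a field_simps power2_eq_square xyz[symmetric]\<close>)
      then show ?thesis using d 1 by (auto simp: f_def exchange_map_nth xyz)
    next
      case 2
      have "g x (exchange_poly \<Omega> q t / y) z = g x y z"
        by (rule vieta_flip[where g = "\<lambda>y. g x y z" and h = "\<lambda>u. (u + of_nat a * z + of_nat c * x) / x / z"])
          (use P 2 xyz0 in \<open>auto simp: g_def b field_simps power2_eq_square xyz[symmetric]\<close>)
      then show ?thesis using d 2 by (auto simp: f_def exchange_map_nth xyz)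
    next
      case 3
      have "g x y (exchange_poly \<Omega> r t / z) = g x y z"
        by (rule vieta_flip[where g = "\<lambda>z. g x y z" and h = "\<lambda>u. (u + of_nat a * y + of_nat b * x) / x / y"])
          (use P 3 xyz0 in \<open>auto simp: g_def c field_simps power2_eq_square xyz[symmetric]\<close>)
      then show ?thesis using d 3 by (auto simp: f_def exchange_map_nth xyz)
    qed
  qed
  \<comment> \<open>\<open>f\<close> is homogeneous of degree -1, hence odd, with value
    \<open>3 + a + b + c\<close> at the all-ones vector.\<close>
  moreover have "f (\<chi> i. 1) \<noteq> f (\<chi> i. - 1)"
  proof
    assume "f (\<chi> i. 1) = f (\<chi> i. - 1)"
    then have "(of_nat (2 * (3 + a + b + c)) :: 'k) = 0"
      by (simp add: f_def g_def algebra_simps)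
    then show False by (simp only: of_nat_eq_0_iff) simp
  qed
  ultimately show ?thesis
    by (intro nonconstant_invariant[OF \<Omega> B, of f "\<chi> i. 1" "\<chi> i. - 1"]) auto
qed

lemma nonconstant_invariant_4_2_1:
  fixes \<Omega> :: "'k::field_char_0 pre_seed"
  assumes \<Omega>: "\<Omega> \<in> seeds"
    and B: "\<And>s. mutate_B s \<Omega> = B_mat \<Omega> \<or> mutate_B s \<Omega> = - B_mat \<Omega>"
    and d: "distinct [p, q, r]"
    and M: "(B_mat \<Omega> ** R_mat \<Omega>) $ q $ p = - 1" "(B_mat \<Omega> ** R_mat \<Omega>) $ r $ p = 1"
      "(B_mat \<Omega> ** R_mat \<Omega>) $ p $ q = 4" "(B_mat \<Omega> ** R_mat \<Omega>) $ r $ q = - 2"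
      "(B_mat \<Omega> ** R_mat \<Omega>) $ p $ r = - 4" "(B_mat \<Omega> ** R_mat \<Omega>) $ q $ r = 2"
  shows "invariant_laurent mutation_group \<Omega> \<noteq> constant_laurent"
proof -
  have qrp: "q \<noteq> p" "r \<noteq> p" using d by auto
  have a: "\<And>x. exchange_poly \<Omega> p x = x $ q + x $ r"
    using exchange_poly_column_1[OF \<Omega>, of p q r] d M by auto
  obtain b where b: "\<And>x. exchange_poly \<Omega> q x = (x $ p ^ 2) ^ 2 + of_nat b * (x $ p ^ 2 * x $ r) + x $ r ^ 2"
    by (rule exchange_poly_column_even_2[OF \<Omega>, of q p r 2]) (use d M in auto)
  obtain c where c: "\<And>x. exchange_poly \<Omega> r x = (x $ p ^ 2) ^ 2 + of_nat c * (x $ p ^ 2 * x $ q) + x $ q ^ 2"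
    by (rule exchange_poly_column_even_2[OF \<Omega>, of r p q 2]) (use d M in auto)
  define g where "g x y z =
    (x ^ 4 + (y + z) ^ 2 + of_nat b * (x ^ 2 * z) + of_nat c * (x ^ 2 * y)) / x / x / y / z"
    for x y z :: 'k
  define f where "f t = g (t $ p) (t $ q) (t $ r)" for t :: "'k ^ 3"
  have "laurent_fun f"
    unfolding f_def g_def by (intro laurent_fun_intros)
  moreover have "f (exchange_map \<Omega> s t) = f t" if nz: "\<And>i. t $ i \<noteq> 0" and P: "exchange_poly \<Omega> s t \<noteq> 0" for s t
  proof -
    define x y z where "x = t $ p" "y = t $ q" "z = t $ r"
    note xyz = this
    have xyz0: "x \<noteq> 0" "y \<noteq> 0" "z \<noteq> 0" using nz by (auto simp: xyz)
    consider "s = p" | "s = q" | "s = r"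
      using UNIV_distinct_3[OF d] by blast
    then show ?thesis
    proof cases
      case 1
      \<comment> \<open>With \<open>u = x + (y + z) / x\<close>, one has
        \<open>x^2 + (y + z)^2 / x^2 = u^2 - 2 * (y + z)\<close>.\<close>
      have "g (exchange_poly \<Omega> p t / x) y z = g x y z"
        by (rule vieta_flip[where g = "\<lambda>x. g x y z" and
              h = "\<lambda>u. (u ^ 2 - 2 * (y + z) + of_nat b * z + of_nat c * y) / y / z"])
          (use P 1 xyz0 in \<open>auto simp: g_def a field_simps eval_nat_numeral xyz[symmetric]\<close>)
      then show ?thesis using d 1 by (auto simp: f_def exchange_map_nth xyz)
    next
      case 2
      \<comment> \<open>The cross term of \<open>(y + z)^2\<close> gives the \<open>2 * z\<close> in
        \<open>h\<close>.\<close>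
      have "g x (exchange_poly \<Omega> q t / y) z = g x y z"
        by (rule vieta_flip[where g = "\<lambda>y. g x y z" and h = "\<lambda>u. (u + 2 * z + of_nat c * x ^ 2) / x / x / z"])
          (use P 2 xyz0 in \<open>auto simp: g_def b field_simps eval_nat_numeral xyz[symmetric]\<close>)
      then show ?thesis using d 2 by (auto simp: f_def exchange_map_nth xyz)
    next
      case 3
      have "g x y (exchange_poly \<Omega> r t / z) = g x y z"
        by (rule vieta_flip[where g = "\<lambda>z. g x y z" and h = "\<lambda>u. (u + 2 * y + of_nat b * x ^ 2) / x / x / y"])
          (use P 3 xyz0 in \<open>auto simp: g_def c field_simps eval_nat_numeral xyz[symmetric]\<close>)
      then show ?thesis using d 3 by (auto simp: f_def exchange_map_nth xyz)
    qed
  qed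
  \<comment> \<open>With weight 1 on \<open>p\<close> and 2 on \<open>q\<close> and
    \<open>r\<close>, \<open>f\<close> has degree -2, so scaling by 2 divides the value
    \<open>5 + b + c\<close> by 4. Negating the all-ones vector would change nothing if
    \<open>b = c = 0\<close>.\<close>
  moreover have "f (\<chi> i. 1) \<noteq> f (\<chi> i. if i = p then 2 else 4)"
  proof
    assume "f (\<chi> i. 1) = f (\<chi> i. if i = p then 2 else 4)"
    then have "(of_nat (48 * (5 + b + c)) :: 'k) = 0"
      using qrp by (simp add: f_def g_def field_simps)
    then show False by (simp only: of_nat_eq_0_iff) simp
  qed
  ultimately show ?thesis
    by (intro nonconstant_invariant[OF \<Omega> B, of f "\<chi> i. 1" "\<chi> i. if i = p then 2 else 4"]) auto
qed

lemma nonconstant_invariant_1_2_4: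
  fixes \<Omega> :: "'k::field_char_0 pre_seed"
  assumes \<Omega>: "\<Omega> \<in> seeds"
    and B: "\<And>s. mutate_B s \<Omega> = B_mat \<Omega> \<or> mutate_B s \<Omega> = - B_mat \<Omega>"
    and d: "distinct [p, q, r]"
    and M: "(B_mat \<Omega> ** R_mat \<Omega>) $ q $ p = - 4" "(B_mat \<Omega> ** R_mat \<Omega>) $ r $ p = 4"
      "(B_mat \<Omega> ** R_mat \<Omega>) $ p $ q = 1" "(B_mat \<Omega> ** R_mat \<Omega>) $ r $ q = - 2"
      "(B_mat \<Omega> ** R_mat \<Omega>) $ p $ r = - 1" "(B_mat \<Omega> ** R_mat \<Omega>) $ q $ r = 2"
  shows "invariant_laurent mutation_group \<Omega> \<noteq> constant_laurent"
proof -
  have qrp: "q \<noteq> p" "r \<noteq> p" using d by auto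
  obtain a e where a: "\<And>x. exchange_poly \<Omega> p x = x $ q ^ 4 + of_nat a * (x $ q ^ 3 * x $ r)
      + of_nat e * (x $ q ^ 2 * x $ r ^ 2) + of_nat a * (x $ q * x $ r ^ 3) + x $ r ^ 4"
    by (rule exchange_poly_column_4_4[OF \<Omega>, of p q r]) (use d M in auto)
  have b: "\<And>x. exchange_poly \<Omega> q x = x $ p + x $ r ^ 2"
    using exchange_poly_column_1[OF \<Omega>, of q p r] d M by auto
  have c: "\<And>x. exchange_poly \<Omega> r x = x $ p + x $ q ^ 2"
    using exchange_poly_column_1[OF \<Omega>, of r p q] d M by auto
  \<comment> \<open>The summand with factor \<open>x\<close> makes the numerator, collected in
    \<open>y\<close>, the quartic \<open>y^4 + a z y^3 + (e z^2 + 2 x) y^2 + a z Q y + Q^2\<close>,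
    where \<open>Q = x + z^2\<close> is the exchange polynomial at \<open>q\<close>. Divided by
    \<open>y^2\<close> it is a polynomial in \<open>y + Q / y\<close>; \<open>z\<close> is symmetric
    to \<open>y\<close>.\<close>
  define g where "g x y z = (x ^ 2 + (y ^ 4 + of_nat a * (y ^ 3 * z) + of_nat e * (y ^ 2 * z ^ 2)
      + of_nat a * (y * z ^ 3) + z ^ 4) + x * (2 * y ^ 2 + 2 * z ^ 2 + of_nat a * (y * z))) / x / y / y / z / z"
    for x y z :: 'k
  define f where "f t = g (t $ p) (t $ q) (t $ r)" for t :: "'k ^ 3"
  have "laurent_fun f"
    unfolding f_def g_def by (intro laurent_fun_intros)
  moreover have "f (exchange_map \<Omega> s t) = f t" if nz: "\<And>i. t $ i \<noteq> 0" and P: "exchange_poly \<Omega> s t \<noteq> 0" for s t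
  proof -
    define x y z where "x = t $ p" "y = t $ q" "z = t $ r"
    note xyz = this
    have xyz0: "x \<noteq> 0" "y \<noteq> 0" "z \<noteq> 0" using nz by (auto simp: xyz)
    consider "s = p" | "s = q" | "s = r"
      using UNIV_distinct_3[OF d] by blast
    then show ?thesis
    proof cases
      case 1
      have "g (exchange_poly \<Omega> p t / x) y z = g x y z"
        by (rule vieta_flip[where g = "\<lambda>x. g x y z" and
              h = "\<lambda>u. (u + 2 * y ^ 2 + 2 * z ^ 2 + of_nat a * (y * z)) / y / y / z / z"])
          (use P 1 xyz0 in \<open>auto simp: g_def a field_simps eval_nat_numeral xyz[symmetric]\<close>)
      then show ?thesis using d 1 by (auto simp: f_def exchange_map_nth xyz)
    next
      case 2
      have "g x (exchange_poly \<Omega> q t / y) z = g x y z"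
        by (rule vieta_flip[where g = "\<lambda>y. g x y z" and
              h = "\<lambda>u. (u ^ 2 - 2 * (x + z ^ 2) + of_nat a * z * u + of_nat e * z ^ 2 + 2 * x) / x / z / z"])
          (use P 2 xyz0 in \<open>auto simp: g_def b field_simps eval_nat_numeral xyz[symmetric]\<close>)
      then show ?thesis using d 2 by (auto simp: f_def exchange_map_nth xyz)
    next
      case 3
      have "g x y (exchange_poly \<Omega> r t / z) = g x y z"
        by (rule vieta_flip[where g = "\<lambda>z. g x y z" and
              h = "\<lambda>u. (u ^ 2 - 2 * (x + y ^ 2) + of_nat a * y * u + of_nat e * y ^ 2 + 2 * x) / x / y / y"])
          (use P 3 xyz0 in \<open>auto simp: g_def c field_simps eval_nat_numeral xyz[symmetric]\<close>)
      then show ?thesis using d 3 by (auto simp: f_def exchange_map_nth xyz)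
    qed
  qed
  \<comment> \<open>With weight 2 on \<open>p\<close> and 1 on \<open>q\<close> and
    \<open>r\<close>, \<open>f\<close> has degree -2, so scaling by 2 divides the value
    \<open>7 + 3 a + e\<close> by 4.\<close>
  moreover have "f (\<chi> i. 1) \<noteq> f (\<chi> i. if i = p then 4 else 2)"
  proof
    assume "f (\<chi> i. 1) = f (\<chi> i. if i = p then 4 else 2)"
    then have "(of_nat (48 * (7 + 3 * a + e)) :: 'k) = 0"
      using qrp by (simp add: f_def g_def field_simps)
    then show False by (simp only: of_nat_eq_0_iff) simp
  qed
  ultimately show ?thesis
    by (intro nonconstant_invariant[OF \<Omega> B, of f "\<chi> i. 1" "\<chi> i. if i = p then 4 else 2"]) auto
qed

section \<open>Classification of the exchange matrices\<close>

text \<open>The map \<open>mutate s\<close> may be presented with another permutation and index; as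
  equal maps agree at \<open>\<Omega>\<close>, the condition holds for
  \<open>mutate s \<Omega>\<close>.\<close>

lemma symmetric_maps_mutate_B:
  fixes \<Omega> :: "'k::field_char_0 pre_seed"
  assumes "mutate s \<in> symmetric_maps \<Omega>"
  shows "mutate_B s \<Omega> = B_mat \<Omega> \<or> mutate_B s \<Omega> = - B_mat \<Omega>"
proof -
  obtain \<sigma> s' x' where "(mutate s :: 'k pre_seed \<Rightarrow> _) = perm_seed \<sigma> \<circ> mutate s'"
    and "perm_seed \<sigma> (mutate s' \<Omega>) = \<Omega>\<lparr>cluster := x'\<rparr> \<or>
         perm_seed \<sigma> (mutate s' \<Omega>) = \<Omega>\<lparr>B_mat := - B_mat \<Omega>, cluster := x'\<rparr>"
    using assms unfolding symmetric_maps_def mem_Collect_eq by (elim exE conjE) (rule that)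
  then have "mutate s \<Omega> = \<Omega>\<lparr>cluster := x'\<rparr> \<or> mutate s \<Omega> = \<Omega>\<lparr>B_mat := - B_mat \<Omega>, cluster := x'\<rparr>"
    by (simp add: fun_eq_iff)
  then show ?thesis
    by (elim disjE) (simp_all flip: mutate_simps(1))
qed

lemma BR_sign:
  assumes \<Omega>: "\<Omega> \<in> seeds"
  shows "(B_mat \<Omega> ** R_mat \<Omega>) $ i $ j > 0 \<longleftrightarrow> (B_mat \<Omega> ** R_mat \<Omega>) $ j $ i < 0"
proof -
  obtain d :: "3 \<Rightarrow> int" where d: "d i > 0" "d j > 0" "d i * B_mat \<Omega> $ i $ j = - (d j * B_mat \<Omega> $ j $ i)"
    using seedsD(1)[OF \<Omega>] unfolding skew_symmetrizable_def by blast
  have "B_mat \<Omega> $ i $ j > 0 \<longleftrightarrow> d i * B_mat \<Omega> $ i $ j > 0"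
    using d(1) by (simp add: zero_less_mult_iff)
  also have "\<dots> \<longleftrightarrow> B_mat \<Omega> $ j $ i < 0"
    unfolding d(3) using d(2) by (simp add: mult_less_0_iff)
  finally show ?thesis
    using seedsD(3)[OF \<Omega>] by (auto simp: BR_nth zero_less_mult_iff mult_less_0_iff)
qed

text \<open>Mutation at \<open>s\<close> negates row and column \<open>s\<close>; if it fixes
  \<open>B\<close>, they equal their negatives.\<close>

lemma BR_fixed:
  assumes "mutate_B s \<Omega> = B_mat \<Omega>"
  shows "(B_mat \<Omega> ** R_mat \<Omega>) $ s $ j = 0" "(B_mat \<Omega> ** R_mat \<Omega>) $ j $ s = 0"
proof -
  have "mutate_B s \<Omega> $ s $ j = - B_mat \<Omega> $ s $ j" "mutate_B s \<Omega> $ j $ s = - B_mat \<Omega> $ j $ s"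
    by (simp_all add: mutate_B_def Let_def)
  then show "(B_mat \<Omega> ** R_mat \<Omega>) $ s $ j = 0" "(B_mat \<Omega> ** R_mat \<Omega>) $ j $ s = 0"
    by (simp_all add: assms BR_nth)
qed

text \<open>Multiplication by \<open>r_j\<close> absorbs \<open>r_s\<close> into \<open>M_is\<close>
  and \<open>r_j\<close> into \<open>M_sj\<close>, so \<open>BR\<close> obeys the mutation rule with
  all degrees 1.\<close>

lemma BR_negated:
  assumes "mutate_B s \<Omega> = - B_mat \<Omega>" "i \<noteq> s" "j \<noteq> s"
  defines "M \<equiv> B_mat \<Omega> ** R_mat \<Omega>"
  shows "2 * M $ i $ j = - (pos_part (M $ i $ s) * M $ s $ j + M $ i $ s * pos_part (- M $ s $ j))"
proof -
  have pp: "pos_part (a * int r) = pos_part a * int r" "pos_part (- (a * int r)) = pos_part (- a) * int r" for a r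
    by (auto simp: pos_part_def max_def mult_le_0_iff zero_le_mult_iff)
  have "mutate_B s \<Omega> $ i $ j = - B_mat \<Omega> $ i $ j"
    using assms by simp
  then have "2 * B_mat \<Omega> $ i $ j = - (int (r_deg \<Omega> s) * (pos_part (B_mat \<Omega> $ i $ s) * B_mat \<Omega> $ s $ j
      + B_mat \<Omega> $ i $ s * pos_part (- B_mat \<Omega> $ s $ j)))"
    using assms(2,3) by (simp add: mutate_B_def Let_def)
  then have "2 * B_mat \<Omega> $ i $ j * int (r_deg \<Omega> j) = - (int (r_deg \<Omega> s) * (pos_part (B_mat \<Omega> $ i $ s) * B_mat \<Omega> $ s $ j
      + B_mat \<Omega> $ i $ s * pos_part (- B_mat \<Omega> $ s $ j))) * int (r_deg \<Omega> j)"
    by (rule arg_cong)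
  then show ?thesis
    unfolding M_def BR_nth pp by (simp add: algebra_simps)
qed

text \<open>Multiplying the equations in pairs shows that four times each of \<open>a * a'\<close>,
  \<open>b * b'\<close>, \<open>c * c'\<close> is the product of the other two, so all three equal
  4. Then \<open>2 * c' = a * b\<close> gives \<open>a * b * c = 8\<close> with factors dividing
  4.\<close>

lemma cyclic_products_cases:
  fixes a b c a' b' c' :: int
  assumes pos: "a > 0" "b > 0" "c > 0" "a' > 0" "b' > 0" "c' > 0"
    and eq: "2 * a = b' * c'" "2 * b = c' * a'" "2 * c = a' * b'" "2 * a' = b * c" "2 * b' = c * a" "2 * c' = a * b"
  shows "a * a' = 4" "b * b' = 4" "c * c' = 4"
    "(a, b, c) \<in> {(2, 2, 2), (1, 2, 4), (2, 4, 1), (4, 1, 2), (4, 2, 1), (2, 1, 4), (1, 4, 2)}"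
proof -
  have "(2 * a) * (2 * a') = (b * b') * (c * c')" "(2 * b) * (2 * b') = (c * c') * (a * a')"
    "(2 * c) * (2 * c') = (a * a') * (b * b')"
    unfolding eq by (simp_all add: algebra_simps)
  then have *: "4 * (a * a') = (b * b') * (c * c')" "4 * (b * b') = (c * c') * (a * a')"
    "4 * (c * c') = (a * a') * (b * b')"
    by (simp_all add: algebra_simps)
  \<comment> \<open>Substituting the second equation into the first gives
    \<open>y^2 = 16\<close>.\<close>
  have prods: "y = 4 \<and> x = z" if "4 * x = y * z" "4 * z = x * y" "x > 0" "y > 0" "z > 0" for x y z :: int
  proof -
    have "16 * x = y * (4 * z)" using that(1) by simp
    also have "\<dots> = (y * y) * x" unfolding that(2) by simp
    finally have "16 * x = (y * y) * x" .
    then have "y ^ 2 = 4 ^ 2" using that(3) by (simp add: power2_eq_square)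
    then have "y = 4" using that(4) by (subst (asm) power_eq_iff_eq_base) auto
    then show ?thesis using that by simp
  qed
  have bb: "b * b' = 4" "a * a' = c * c'"
    using prods[OF *(1,3)] pos by auto
  then show aa: "a * a' = 4" and bb': "b * b' = 4" and cc: "c * c' = 4"
    using prods[of "b * b'" "a * a'" "c * c'"] * pos by (auto simp: mult.commute)
  have "a dvd 4" "b dvd 4"
    using aa bb' by (metis dvd_triv_left)+
  then have "a \<le> 4" "b \<le> 4"
    by (auto dest: zdvd_imp_le)
  then have "a = 1 \<or> a = 2 \<or> a = 3 \<or> a = 4" "b = 1 \<or> b = 2 \<or> b = 3 \<or> b = 4"
    using pos by linarith+
  then show "(a, b, c) \<in> {(2, 2, 2), (1, 2, 4), (2, 4, 1), (4, 1, 2), (4, 2, 1), (2, 1, 4), (1, 4, 2)}"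
    using aa bb' cc eq(6) by (elim disjE) (auto, presburger+)
qed

text \<open>Start from a positive entry \<open>M $ p $ q\<close>. Either the third index is
  isolated, or the positive entries form a cycle \<open>p, q, r\<close> and
  \<open>cyclic_products_cases\<close> applies to the absolute values.\<close>

lemma sign_skew_mutation_cases:
  fixes M :: "int ^ 3 ^ 3"
  assumes sgn: "\<And>i j. M $ i $ j > 0 \<longleftrightarrow> M $ j $ i < 0"
    and mut: "\<And>s. (\<forall>j. M $ s $ j = 0 \<and> M $ j $ s = 0) \<or>
      (\<forall>i j. i \<noteq> s \<longrightarrow> j \<noteq> s \<longrightarrow>
        2 * M $ i $ j = - (pos_part (M $ i $ s) * M $ s $ j + M $ i $ s * pos_part (- M $ s $ j)))"
  obtains "M = 0"
    | p q r where "distinct [p, q, r]" "M $ p $ q \<noteq> 0" "M $ q $ p \<noteq> 0" "\<And>j. M $ r $ j = 0 \<and> M $ j $ r = 0"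
    | p q r where "distinct [p, q, r]"
        "(M $ p $ q, M $ p $ r, M $ q $ p, M $ q $ r, M $ r $ p, M $ r $ q)
         \<in> {(2, - 2, - 2, 2, 2, - 2), (1, - 1, - 4, 2, 4, - 2), (4, - 4, - 1, 2, 1, - 2)}"
proof (cases "M = 0")
  case False
  then obtain i j where ij: "M $ i $ j \<noteq> 0"
    by (auto simp: vec_eq_iff)
  obtain p q where pq: "M $ p $ q > 0"
    using ij sgn[of i j] sgn[of j i] by (metis linorder_less_linear)
  then have qp: "M $ q $ p < 0"
    using sgn by blast
  then have "p \<noteq> q" using pq by auto
  then have "card {p, q} < card (UNIV :: 3 set)" by simp
  then obtain r where "r \<notin> {p, q}"
    by (metis UNIV_eq_I less_irrefl)
  then have d: "distinct [p, q, r]"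
    using \<open>p \<noteq> q\<close> by auto
  have U: "x = p \<or> x = q \<or> x = r" for x
    using UNIV_distinct_3[OF d] by blast
  have diag: "M $ i $ i = 0" for i
    using sgn[of i i] by auto
  \<comment> \<open>A nonzero entry in row \<open>s\<close> excludes the first alternative of
    \<open>mut\<close>.\<close>
  have mut': "2 * M $ i $ j = - (pos_part (M $ i $ s) * M $ s $ j + M $ i $ s * pos_part (- M $ s $ j))"
    if "M $ s $ k \<noteq> 0" "i \<noteq> s" "j \<noteq> s" for s k i j
    using mut[of s] that by metis
  have mp: "2 * M $ q $ r = - (M $ q $ p * pos_part (- M $ p $ r))"
    "2 * M $ r $ q = - (pos_part (M $ r $ p) * M $ p $ q)"
    using mut'[of p q q r] mut'[of p q r q] pq qp d by (auto simp: pos_part_def)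
  have px: "pos_part x = x + pos_part (- x)" for x
    by (simp add: pos_part_def)
  have pos_pq: "pos_part (M $ p $ q) = M $ p $ q" "pos_part (- M $ q $ p) = - M $ q $ p"
    using pq qp by (simp_all add: pos_part_def)
  have mq: "2 * M $ p $ r = - (M $ p $ q * pos_part (M $ q $ r))"
    "2 * M $ r $ p = - (pos_part (M $ r $ q) * M $ q $ p + M $ r $ q * - M $ q $ p)"
    using mut'[of q p p r] mut'[of q p r p] pq qp d px[of "M $ q $ r"]
    by (auto simp: pos_pq distrib_left)
  show thesis
  proof (cases "M $ q $ r > 0")
    case False
    \<comment> \<open>Mutation at \<open>q\<close> kills \<open>M $ p $ r\<close>, and then mutation
      at \<open>p\<close> kills \<open>M $ q $ r\<close>.\<close>
    then have pr0: "M $ p $ r = 0" using mq(1) by (simp add: pos_part_def)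
    then have qr0: "M $ q $ r = 0" using mp(1) by (simp add: pos_part_def)
    have "M $ r $ j = 0 \<and> M $ j $ r = 0" for j
    proof -
      have "M $ r $ p = 0" "M $ r $ q = 0"
        using sgn[of r p] sgn[of p r] sgn[of r q] sgn[of q r] pr0 qr0 by auto
      then show ?thesis
        using U[of j] pr0 qr0 diag[of r] by (elim disjE) simp_all
    qed
    then show thesis
      using that(2)[OF d] pq qp by simp
  next
    case True
    have rq: "M $ r $ q < 0" using True sgn by blast
    have "pos_part (M $ q $ r) > 0" using True by (simp add: pos_part_def)
    then have "M $ p $ q * pos_part (M $ q $ r) > 0" using pq by simp
    then have pr: "M $ p $ r < 0" using mq(1) by linarith
    then have rp: "M $ r $ p > 0" using sgn by blast
    \<comment> \<open>Row \<open>r\<close> is now known to be nonzero, so the relation at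
      \<open>r\<close> becomes available too.\<close>
    have mr: "2 * M $ p $ q = - (M $ p $ r * - M $ r $ q)"
      "2 * M $ q $ p = - (M $ q $ r * M $ r $ p)"
      using mut'[of r p p q] mut'[of r p q p] True rq pr rp d by (auto simp: pos_part_def max_def)
    let ?a = "M $ p $ q" and ?b = "M $ q $ r" and ?c = "M $ r $ p"
    let ?a' = "- M $ q $ p" and ?b' = "- M $ r $ q" and ?c' = "- M $ p $ r"
    have eqs: "2 * ?a = ?b' * ?c'" "2 * ?b = ?c' * ?a'" "2 * ?c = ?a' * ?b'" "2 * ?a' = ?b * ?c"
        "2 * ?b' = ?c * ?a" "2 * ?c' = ?a * ?b"
      using mr mp mq True rq pr rp by (auto simp: pos_part_def max_def algebra_simps)
    have pos: "?a > 0" "?b > 0" "?c > 0" "?a' > 0" "?b' > 0" "?c' > 0"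
      using pq True rp qp rq pr by auto
    note * = cyclic_products_cases[OF pos eqs]
    \<comment> \<open>The seven triples form three orbits under rotation, that is, under cyclic
      renaming of \<open>p, q, r\<close>.\<close>
    have "(?a, ?b, ?c) \<in> {(2, 2, 2), (1, 2, 4), (4, 2, 1)} \<or> (?b, ?c, ?a) \<in> {(1, 2, 4), (4, 2, 1)} \<or>
      (?c, ?a, ?b) \<in> {(1, 2, 4), (4, 2, 1)}"
      using *(4) by auto
    then show thesis
    proof (elim disjE)
      assume "(?a, ?b, ?c) \<in> {(2, 2, 2), (1, 2, 4), (4, 2, 1)}"
      then show thesis
        using *(1-3) by (intro that(3)[OF d]) auto
    next
      assume "(?b, ?c, ?a) \<in> {(1, 2, 4), (4, 2, 1)}"
      then show thesis
        using *(1-3) d by (intro that(3)[of q r p]) auto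
    next
      assume "(?c, ?a, ?b) \<in> {(1, 2, 4), (4, 2, 1)}"
      then show thesis
        using *(1-3) d by (intro that(3)[of r p q]) auto
    qed
  qed
qed (rule that(1))

section \<open>Matrices up to permutation, and the two equivalences\<close>

lemma ex_perm_mat:
  fixes A M :: "int ^ 3 ^ 3"
  assumes d: "distinct [p, q, r]"
    and "M $ p $ p = A $ 1 $ 1" "M $ p $ q = A $ 1 $ 2" "M $ p $ r = A $ 1 $ 3"
      "M $ q $ p = A $ 2 $ 1" "M $ q $ q = A $ 2 $ 2" "M $ q $ r = A $ 2 $ 3"
      "M $ r $ p = A $ 3 $ 1" "M $ r $ q = A $ 3 $ 2" "M $ r $ r = A $ 3 $ 3"
  shows "\<exists>\<sigma>. \<sigma> permutes UNIV \<and> M = perm_mat \<sigma> A"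
proof -
  define \<sigma> :: "3 \<Rightarrow> 3" where "\<sigma> i = (if i = p then 1 else if i = q then 2 else 3)" for i
  have \<sigma>: "\<sigma> p = 1" "\<sigma> q = 2" "\<sigma> r = 3"
    using d by (auto simp: \<sigma>_def)
  have U: "x = p \<or> x = q \<or> x = r" for x
    using UNIV_distinct_3[OF d] by blast
  have "inj \<sigma>"
  proof (rule injI)
    fix x y assume "\<sigma> x = \<sigma> y"
    then show "x = y"
      using U[of x] U[of y] by (elim disjE) (simp_all add: \<sigma>)
  qed
  then have "\<sigma> permutes UNIV"
    by (intro bij_imp_permutes bijI finite_UNIV_inj_surj) auto
  moreover have "M $ i $ j = perm_mat \<sigma> A $ i $ j" for i j
    using U[of i] U[of j] assms(2-) by (elim disjE) (simp_all add: perm_mat_def \<sigma>)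
  then have "M = perm_mat \<sigma> A"
    by (simp add: vec_eq_iff)
  ultimately show ?thesis by blast
qed

theorem proposition3p31:
  fixes \<Omega> :: "'k::field_char_0 pre_seed"
  assumes "\<Omega> \<in> seeds"
    and "mutate 1 \<in> symmetric_maps \<Omega>"
    and "mutate 2 \<in> symmetric_maps \<Omega>"
    and "mutate 3 \<in> symmetric_maps \<Omega>"
  shows "((\<forall>i. mutate_B i \<Omega> = - B_mat \<Omega>) \<longrightarrow>
      (invariant_laurent mutation_group \<Omega> \<noteq> constant_laurent \<longleftrightarrow>
        (\<exists>A\<in>{A1, A2, A3, A4}. \<exists>\<sigma>. \<sigma> permutes UNIV \<and>
          B_mat \<Omega> ** R_mat \<Omega> = perm_mat \<sigma> A))) \<and>
    (invariant_laurent mutation_group \<Omega> \<noteq> constant_laurent \<longleftrightarrow>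
      (\<exists>A\<in>{A1, A2, A3, A4} \<union> {A5 b c | b c. b \<noteq> 0 \<and> c \<noteq> 0}. \<exists>\<sigma>. \<sigma> permutes UNIV \<and>
        B_mat \<Omega> ** R_mat \<Omega> = perm_mat \<sigma> A))"
proof -
  define M where "M = B_mat \<Omega> ** R_mat \<Omega>"
  note \<Omega> = assms(1)
  have B: "mutate_B s \<Omega> = B_mat \<Omega> \<or> mutate_B s \<Omega> = - B_mat \<Omega>" for s
    using symmetric_maps_mutate_B assms(2-4) exhaust_3[of s] by metis
  have diag: "M $ i $ i = 0" for i
    unfolding M_def BR_nth using seeds_diag[OF \<Omega>] by simp
  have mut: "(\<forall>j. M $ s $ j = 0 \<and> M $ j $ s = 0) \<or>
      (\<forall>i j. i \<noteq> s \<longrightarrow> j \<noteq> s \<longrightarrow>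
        2 * M $ i $ j = - (pos_part (M $ i $ s) * M $ s $ j + M $ i $ s * pos_part (- M $ s $ j)))" for s
    using B[of s] BR_fixed[of s \<Omega>] BR_negated[of s \<Omega>] unfolding M_def by blast
  show ?thesis
  proof (rule sign_skew_mutation_cases[OF BR_sign[OF \<Omega>, folded M_def] mut])
    assume "M = 0"
    then have "M = perm_mat id A1"
      by (simp add: perm_mat_def A1_def vec_eq_iff)
    then have "\<exists>\<sigma>. \<sigma> permutes UNIV \<and> M = perm_mat \<sigma> A1"
      using permutes_id by blast
    moreover have "invariant_laurent mutation_group \<Omega> \<noteq> constant_laurent"
      using \<open>M = 0\<close> by (intro nonconstant_invariant_zero_column[OF \<Omega> B, of 1 2 3]) (auto simp: M_def)
    ultimately show ?thesis unfolding M_def[symmetric] by blast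
  next
    fix p q r :: 3
    assume d: "distinct [p, q, r]" and M: "M $ p $ q \<noteq> 0" "M $ q $ p \<noteq> 0"
      and r: "\<And>j. M $ r $ j = 0 \<and> M $ j $ r = 0"
    have "\<exists>\<sigma>. \<sigma> permutes UNIV \<and> M = perm_mat \<sigma> (A5 (M $ p $ q) (M $ q $ p))"
      using diag r by (intro ex_perm_mat[OF d]) (simp_all add: A5_def mat3_def)
    moreover have "A5 (M $ p $ q) (M $ q $ p) \<in> {A5 b c | b c. b \<noteq> 0 \<and> c \<noteq> 0}"
      using M by blast
    moreover have "invariant_laurent mutation_group \<Omega> \<noteq> constant_laurent"
      using d r by (intro nonconstant_invariant_zero_column[OF \<Omega> B, of r p q]) (auto simp: M_def)
    \<comment> \<open>Row and column \<open>r\<close> vanish, so mutation at \<open>r\<close> has no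
      correction term and cannot negate the nonzero entry \<open>M $ p $ q\<close>; the hypothesis
      of (i) fails here.\<close>
    moreover have "\<not> (\<forall>i. mutate_B i \<Omega> = - B_mat \<Omega>)"
    proof
      assume "\<forall>i. mutate_B i \<Omega> = - B_mat \<Omega>"
      then have "2 * M $ p $ q = 0"
        using BR_negated[of r \<Omega> p q, folded M_def] d r by (simp add: pos_part_def)
      with M(1) show False by simp
    qed
    ultimately show ?thesis unfolding M_def[symmetric] by blast
  next
    fix p q r :: 3
    assume d: "distinct [p, q, r]"
      and M: "(M $ p $ q, M $ p $ r, M $ q $ p, M $ q $ r, M $ r $ p, M $ r $ q)
         \<in> {(2, - 2, - 2, 2, 2, - 2), (1, - 1, - 4, 2, 4, - 2), (4, - 4, - 1, 2, 1, - 2)}"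
    have "\<exists>A\<in>{A2, A3, A4}. \<exists>\<sigma>. \<sigma> permutes UNIV \<and> M = perm_mat \<sigma> A"
    proof -
      \<comment> \<open>The entry \<open>M $ p $ q\<close> is 2, 1 or 4 and tells the three cases
        apart.\<close>
      define A where "A = (if M $ p $ q = 2 then A2 else if M $ p $ q = 1 then A3 else A4)"
      have "\<exists>\<sigma>. \<sigma> permutes UNIV \<and> M = perm_mat \<sigma> A"
        using M diag by (intro ex_perm_mat[OF d]) (auto simp: A_def A2_def A3_def A4_def mat3_def)
      moreover have "A \<in> {A2, A3, A4}"
        by (simp add: A_def)
      ultimately show ?thesis by blast
    qed
    moreover have "invariant_laurent mutation_group \<Omega> \<noteq> constant_laurent"
      using M nonconstant_invariant_2_2_2[OF \<Omega> B d, folded M_def]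
        nonconstant_invariant_1_2_4[OF \<Omega> B d, folded M_def]
        nonconstant_invariant_4_2_1[OF \<Omega> B d, folded M_def] by auto
    ultimately show ?thesis unfolding M_def[symmetric] by blast
  qed
qed

end
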